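(* Let $f\in\mathcal{C}^1(\mathbb{R}^2)\cap\mathcal{A}$ be supported in $\mathbb{B}^\circ$ and let $(m,n)\in\mathbb{Z}\times\mathbb{N}$. Then there exist constants $\gamma_{m,n}>0$ (depending only on $(m,n)$) and $c_f>0$ (depending only on $f$) such that $$\left|C_{m,n}(f)-C_{m,n}^{K}(f)\right|\le\frac{2\gamma_{m,n}c_f}{K}\qquad\text{for every } K\in\mathbb{N}\text{ with } K\ge K_{m,n}.$$
   Context: $\mathbb{N}=\{1,2,\dots\}$. $\mathbb{B}$ and $\mathbb{B}^\circ$ are the closed and open unit disks of $\mathbb{R}^2$; $\mathrm{supp}(f)=\{\mathbf{x}: f(\mathbf{x})\neq 0\}$ and $f$ is supported in $X$ if $\mathrm{supp}(f)\subseteq X$. $\mathcal{C}^q(\mathbb{R}^2)$ is the set of functions $\mathbb{R}^2\to\mathbb{C}$ all of whose partial derivatives of order $\le q$ exist and are continuous. $\mathcal{V}$ is the set of square integrable $f:\mathbb{R}^2\to\mathbb{C}$ supported in $\mathbb{B}$. For $\mathbf{k}\in\mathbb{Z}^2$, $\widehat f(\mathbf{k})=\int_{\mathbb{R}^2}f(\mathbf{x})e^{-\mathrm{i}\pi\langle\mathbf{k},\mathbf{x}\rangle}\,d\mathbf{x}$. $\mathcal{A}=\{f\in\mathcal{V}:\sum_{\mathbf{k}\in\mathbb{Z}^2}|\widehat f(\mathbf{k})|<\infty\}$. Bessel notation: $J_m$ is the Bessel function of the first kind of order $m\in\mathbb{Z}$, $0<z_{m,1}<z_{m,2}<\cdots$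 are its positive zeros, and $K_{m,n}:=\lceil z_{m,n}/\pi\rceil$. In polar coordinates, $\Psi_{m,n}(r,\theta)=\frac{e^{\mathrm{i}m\theta}J_m(z_{m,n}r)}{\sqrt{\pi}\,|J_{m+1}(z_{m,n})|}$ if $r\le 1$, and $0$ if $r>1$. The Fourier-Bessel coefficient is $C_{m,n}(f)=\int_0^{2\pi}\int_0^1 f(r,\theta)\overline{\Psi_{m,n}(r,\theta)}\,r\,dr\,d\theta$. Finite Fourier transform: for $L\in\mathbb{N}$, $\widehat f(\mathbf{k};L)=\delta^2\sum_{i=1}^L\sum_{j=1}^L f(x_i,x_j)e^{-\pi\mathrm{i}(k_1x_i+k_2x_j)}$ with $\delta=2/L$, $x_i=-1+(i-1)\delta$. Coefficients: for $\mathbf{k}=(k_1,k_2)\in\mathbb{Z}^2$, $\mathbf{c}(\mathbf{k};m,n)=\varepsilon_m\sqrt{\pi}(-1)^n\mathrm{i}^m z_{m,n}\frac{J_m(\pi\|\mathbf{k}\|_2)e^{-\mathrm{i}m\Phi(\mathbf{k})}}{2(\pi^2\|\mathbf{k}\|_2^2-z_{m,n}^2)}$, where $\varepsilon_m=1$ if $m\ge0$, $\varepsilon_m=(-1)^m$ if $m<0$, and $\Phi(\mathbf{k})=\mathrm{atan2}(k_2,k_1)$ is the polar angle of $\mathbf{k}$ (with value $0$ at $\mathbf{k}=0$). If $\pi\|\mathbf{k}\|_2=z_{m,n}$, the quotient $J_m(\pi\|\mathbf{k}\|_2)/(\pi^2\|\mathbf{k}\|_2^2-z_{m,n}^2)$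 is understood as its limiting value $J_m'(z_{m,n})/(2z_{m,n})$. Finite Fourier-Bessel transform of order $K\in\mathbb{N}$: $C_{m,n}^K(f)=\sum_{\mathbf{k}\in\mathbb{Z}^2,\ \|\mathbf{k}\|_\infty\le K}\mathbf{c}(\mathbf{k};m,n)\,\widehat f(\mathbf{k};2K+1)$. *)

theory Defs
  imports "HOL-Analysis.Analysis"
begin

section \<open>Function spaces on the plane\<close>

text \<open>The plane is \<^typ>\<open>real \<times> real\<close>, whose library norm is the Euclidean one.\<close>

text \<open>The support is the plain nonvanishing set; no closure is taken.\<close>

definition supp :: "(real \<times> real \<Rightarrow> complex) \<Rightarrow> (real \<times> real) set"
  where "supp f = {x. f x \<noteq> 0}"

primrec Cdiff :: "nat \<Rightarrow> (real \<times> real \<Rightarrow> complex) set"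
  where
    "Cdiff 0 = {f. continuous_on UNIV f}"
  | "Cdiff (Suc q) = {f. continuous_on UNIV f \<and>
       (\<exists>f1\<in>Cdiff q. \<exists>f2\<in>Cdiff q. \<forall>x y.
          ((\<lambda>s. f (s, y)) has_vector_derivative f1 (x, y)) (at x) \<and>
          ((\<lambda>t. f (x, t)) has_vector_derivative f2 (x, y)) (at y))}"

definition square_integrable_disk :: "(real \<times> real \<Rightarrow> complex) set"
  where "square_integrable_disk = {f. f \<in> borel_measurable lebesgue \<and>
           integrable lebesgue (\<lambda>x. (norm (f x))\<^sup>2) \<and> supp f \<subseteq> cball 0 1}"

definition fourier_coeff :: "(real \<times> real \<Rightarrow> complex) \<Rightarrow> int \<times> int \<Rightarrow> complex"
  where "fourier_coeff f k = (LINT x|lebesgue. f x *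
           exp (- (\<i> * complex_of_real (pi * (of_int (fst k) * fst x + of_int (snd k) * snd x)))))"

definition abs_conv_fourier :: "(real \<times> real \<Rightarrow> complex) set"
  where "abs_conv_fourier = {f \<in> square_integrable_disk.
           (\<lambda>k. norm (fourier_coeff f k)) summable_on UNIV}"

section \<open>Bessel functions and Fourier-Bessel coefficients\<close>

definition eps :: "int \<Rightarrow> real"
  where "eps m = (if m \<ge> 0 then 1 else (-1) powi m)"

text \<open>The usual power series for nonnegative integer order, extended by
  \<open>J\<^sub>-\<^sub>m = (-1)\<^sup>m J\<^sub>m\<close>.\<close>

definition bessel_J :: "int \<Rightarrow> real \<Rightarrow> real"
  where "bessel_J m x = eps m * (\<Sum>j. (-1) ^ j / (fact j * fact (j + nat \<bar>m\<bar>)) *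
           (x / 2) ^ (2 * j + nat \<bar>m\<bar>))"

text \<open>For \<open>n \<ge> 1\<close> this is the \<open>n\<close>-th positive zero; index \<open>0\<close> only starts the recursion.\<close>

primrec bessel_zero :: "int \<Rightarrow> nat \<Rightarrow> real"
  where
    "bessel_zero m 0 = 0"
  | "bessel_zero m (Suc n) = Inf {x. x > bessel_zero m n \<and> bessel_J m x = 0}"

definition K_min :: "int \<Rightarrow> nat \<Rightarrow> int"
  where "K_min m n = \<lceil>bessel_zero m n / pi\<rceil>"

definition Psi :: "int \<Rightarrow> nat \<Rightarrow> real \<Rightarrow> real \<Rightarrow> complex"
  where "Psi m n r \<theta> = (if r \<le> 1
           then exp (\<i> * of_int m * complex_of_real \<theta>) *
                complex_of_real (bessel_J m (bessel_zero m n * r)) /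
                complex_of_real (sqrt pi * \<bar>bessel_J (m + 1) (bessel_zero m n)\<bar>)
           else 0)"

definition fourier_bessel_coeff :: "int \<Rightarrow> nat \<Rightarrow> (real \<times> real \<Rightarrow> complex) \<Rightarrow> complex"
  where "fourier_bessel_coeff m n f =
           (LINT \<theta>:{0..2 * pi}|lebesgue. (LINT r:{0..1}|lebesgue.
              f (r * cos \<theta>, r * sin \<theta>) * cnj (Psi m n r \<theta>) * complex_of_real r))"

section \<open>Finite transforms\<close>

definition grid_pt :: "nat \<Rightarrow> nat \<Rightarrow> real"
  where "grid_pt L i = -1 + (real i - 1) * (2 / real L)"

definition finite_fourier :: "nat \<Rightarrow> (real \<times> real \<Rightarrow> complex) \<Rightarrow> int \<times> int \<Rightarrow> complex"
  where "finite_fourier L f k = complex_of_real ((2 / real L)\<^sup>2) *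
           (\<Sum>i=1..L. \<Sum>j=1..L. f (grid_pt L i, grid_pt L j) *
              exp (- (complex_of_real pi * \<i> * complex_of_real
                (of_int (fst k) * grid_pt L i + of_int (snd k) * grid_pt L j))))"

definition norm2 :: "int \<times> int \<Rightarrow> real"
  where "norm2 k = sqrt ((of_int (fst k))\<^sup>2 + (of_int (snd k))\<^sup>2)"

text \<open>\<^const>\<open>Arg\<close> takes values in \<open>(-\<pi>, \<pi>]\<close> and \<open>Arg 0 = 0\<close>, as for atan2.\<close>

definition polar_angle :: "int \<times> int \<Rightarrow> real"
  where "polar_angle k = Arg (Complex (of_int (fst k)) (of_int (snd k)))"

text \<open>The quotient \<open>J\<^sub>m(a) / (a\<^sup>2 - z\<^sup>2)\<close>, with its limiting value at the
  removable singularity \<open>a = z\<close>.\<close>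

definition bessel_quot :: "int \<Rightarrow> nat \<Rightarrow> real \<Rightarrow> real"
  where "bessel_quot m n a =
           (if a = bessel_zero m n
            then deriv (bessel_J m) (bessel_zero m n) / (2 * bessel_zero m n)
            else bessel_J m a / (a\<^sup>2 - (bessel_zero m n)\<^sup>2))"

definition c_coeff :: "int \<times> int \<Rightarrow> int \<Rightarrow> nat \<Rightarrow> complex"
  where "c_coeff k m n =
           complex_of_real (eps m * sqrt pi * (-1) ^ n) * \<i> powi m *
           complex_of_real (bessel_zero m n * bessel_quot m n (pi * norm2 k) / 2) *
           exp (- (\<i> * of_int m * complex_of_real (polar_angle k)))"

definition finite_fourier_bessel ::
    "nat \<Rightarrow> int \<Rightarrow> nat \<Rightarrow> (real \<times> real \<Rightarrow> complex) \<Rightarrow> complex"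
  where "finite_fourier_bessel K m n f =
           (\<Sum>k | max \<bar>fst k\<bar> \<bar>snd k\<bar> \<le> int K.
              c_coeff k m n * finite_fourier (2 * K + 1) f k)"

end

theory Submission
  imports Defs
begin

text \<open>
  Expanding \<open>f\<close> in its Fourier series on \<open>[-1, 1]\<^sup>2\<close> and integrating against \<open>cnj \<Psi>\<^sub>m\<^sub>n\<close> term by term
  (Jacobi-Anger in the angle, Lommel's integral in the radius) shows that the Fourier-Bessel
  coefficient is \<open>\<Sum>\<^sub>k c(k; m, n) f^(k)\<close>. The Bessel equation gives \<open>J\<^sub>m(x) = O(1 / sqrt x)\<close>, so
  \<open>c(k; m, n) = O(\<bar>k\<bar> powr (-5/2))\<close> is absolutely summable over the lattice. The terms with
  \<open>\<bar>k\<bar> > K\<close> are therefore \<open>O(1/K)\<close> in total, and for the others it is enough that the finite Fourier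
  transform approximates the Fourier coefficient with error \<open>O(1/K)\<close> uniformly in \<open>\<bar>k\<bar> \<le> K\<close>. This
  last estimate does not lose a factor \<open>\<bar>k\<bar>\<close> because the finite transform of a Lipschitz function is
  itself \<open>O(1/\<bar>k\<bar>)\<close>.
\<close>

section \<open>Bessel functions of nonnegative integer order\<close>

text \<open>The zeros are given only by a recursive infimum, so existence, positivity and simplicity
  of every \<open>bessel_zero m n\<close> with \<open>n\<close> at least 1 have to be derived,
  together with the sign of the derivative there. That sign alternates with \<open>n\<close>; since
  \<open>Psi\<close> is normalised by an absolute value, it survives as the factor
  \<open>(-1) ^ n\<close> of \<open>c_coeff\<close>. A single energy function yields both the decay
  of the Bessel functions and the simplicity of their zeros. The Fourier coefficients of
  \<open>f\<close> are controlled only through their absolute summability, so the two parts of the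
  error are paired differently. Beyond the box, the supremum of the norms of \<open>c_coeff\<close>,
  at most a constant over \<open>K\<close>, multiplies the sum of the norms of the Fourier
  coefficients. Inside the box, the uniform error of the finite transform multiplies the sum of the
  norms of \<open>c_coeff\<close>. Support in the open disk makes \<open>f\<close> vanish on the
  boundary of the square [-1, 1] x [-1, 1], so summation by parts leaves no boundary terms. The
  recurring factor 4 is the area of that square: the Fourier series there represents
  \<open>4 * f\<close>.\<close>

definition bes_coeff :: "nat \<Rightarrow> nat \<Rightarrow> real"
  where "bes_coeff N j = (-1) ^ j / (fact j * fact (j + N))"

text \<open>A Bessel-Clifford function. With the power \<open>(x / 2) ^ N\<close> split off, the
  remaining series is entire in \<open>(x / 2)\<^sup>2\<close>, and differentiation merely raises
  the index \<open>N\<close>.\<close>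

definition bes_ser :: "nat \<Rightarrow> real \<Rightarrow> real"
  where "bes_ser N t = (\<Sum>j. bes_coeff N j * t ^ j)"

definition bes :: "nat \<Rightarrow> real \<Rightarrow> real"
  where "bes N x = (x / 2) ^ N * bes_ser N ((x / 2)\<^sup>2)"

text \<open>On \<open>x > 0\<close> this is \<open>x J\<^sub>N'(x)\<close>; unlike the quotient form it is smooth at \<open>0\<close>.\<close>

definition xbes' :: "nat \<Rightarrow> real \<Rightarrow> real"
  where "xbes' N x = real N * bes N x - x * bes (Suc N) x"

section \<open>Power series, recurrences and the Bessel equation\<close>

lemma summable_bes_coeff: "summable (\<lambda>j. bes_coeff N j * t ^ j)"
proof (rule summable_comparison_test)
  show "summable (\<lambda>j. inverse (fact j) * \<bar>t\<bar> ^ j)"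
    by (rule summable_exp)
  have "norm (bes_coeff N j * t ^ j) \<le> inverse (fact j) * \<bar>t\<bar> ^ j" for j
  proof -
    have "1 / (fact j * fact (j + N)) \<le> (1 / fact j :: real)"
      by (simp add: divide_simps)
    then show ?thesis
      using mult_right_mono [of "1 / (fact j * fact (j + N))" "1 / fact j" "\<bar>t\<bar> ^ j"]
      by (simp add: bes_coeff_def abs_mult power_abs inverse_eq_divide)
  qed
  then show "\<exists>M. \<forall>j\<ge>M. norm (bes_coeff N j * t ^ j) \<le> inverse (fact j) * \<bar>t\<bar> ^ j"
    by blast
qed

lemma diffs_bes_coeff: "diffs (bes_coeff N) j = - bes_coeff (Suc N) j"
  by (simp add: diffs_def bes_coeff_def divide_simps)

lemma DERIV_bes_ser: "DERIV (bes_ser N) t :> - bes_ser (Suc N) t"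
proof -
  have "DERIV (\<lambda>x. \<Sum>n. bes_coeff N n * x ^ n) t :> (\<Sum>n. diffs (bes_coeff N) n * t ^ n)"
    by (rule termdiffs_strong_converges_everywhere) (rule summable_bes_coeff)
  also have "(\<Sum>n. diffs (bes_coeff N) n * t ^ n) = - bes_ser (Suc N) t"
    unfolding bes_ser_def
    by (subst suminf_minus [symmetric]) (auto simp: diffs_bes_coeff summable_bes_coeff)
  finally show ?thesis
    unfolding bes_ser_def [abs_def] .
qed

text \<open>Compared coefficient by coefficient: multiplication by \<open>t\<close> shifts the last
  series by one place, and the two contributions to \<open>t ^ j\<close> carry the factors
  \<open>N + 1\<close> and \<open>j\<close>, whose sum cancels the top factor of
  \<open>fact (j + N + 1)\<close>.\<close>

lemma bes_ser_recurrence: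
  "bes_ser N t = real (Suc N) * bes_ser (Suc N) t - t * bes_ser (Suc (Suc N)) t"
proof -
  have s: "(\<lambda>j. bes_coeff M j * t ^ j) sums bes_ser M t" for M
    unfolding bes_ser_def by (intro summable_sums summable_bes_coeff)
  have "(\<lambda>j. case j of 0 \<Rightarrow> 0 | Suc i \<Rightarrow> t * (bes_coeff (Suc (Suc N)) i * t ^ i))
      sums (t * bes_ser (Suc (Suc N)) t)"
    using sums_mult [OF s, of t "Suc (Suc N)"]
    by (subst sums_Suc_iff [symmetric, where f="\<lambda>j. case j of 0 \<Rightarrow> 0 | Suc i \<Rightarrow> _ i" and s="t * bes_ser (Suc (Suc N)) t", simplified]) simp
  from sums_diff [OF sums_mult [OF s, of "real (Suc N)" "Suc N"] this]
  have "(\<lambda>j. bes_coeff N j * t ^ j) sums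
     (real (Suc N) * bes_ser (Suc N) t - t * bes_ser (Suc (Suc N)) t)"
  proof (rule sums_cong [THEN iffD1, rotated])
    fix j
    show "real (Suc N) * (bes_coeff (Suc N) j * t ^ j) -
         (case j of 0 \<Rightarrow> 0 | Suc i \<Rightarrow> t * (bes_coeff (Suc (Suc N)) i * t ^ i)) =
         bes_coeff N j * t ^ j"
    proof (cases j)
      case 0
      then show ?thesis by (simp add: bes_coeff_def divide_simps)
    next
      case (Suc i)
      have "real (Suc N) * bes_coeff (Suc N) (Suc i) - bes_coeff (Suc (Suc N)) i
          = bes_coeff N (Suc i)"
        by (simp add: bes_coeff_def divide_simps) (simp add: algebra_simps)
      then have "(real (Suc N) * bes_coeff (Suc N) (Suc i) - bes_coeff (Suc (Suc N)) i) * t ^ Suc i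
          = bes_coeff N (Suc i) * t ^ Suc i" by simp
      then show ?thesis unfolding Suc by (simp add: algebra_simps)
    qed
  qed
  then show ?thesis
    using s sums_unique2 by blast
qed

text \<open>The three-term recurrence of the Bessel functions, multiplied through by
  \<open>x\<close> so that \<open>x = 0\<close> needs no separate treatment.\<close>

lemma bes_recurrence: "x * bes N x + x * bes (Suc (Suc N)) x = 2 * real (Suc N) * bes (Suc N) x"
proof -
  have "x * bes N x = 2 * (x / 2) ^ Suc N * bes_ser N ((x / 2)\<^sup>2)"
    by (simp add: bes_def)
  also have "\<dots> = 2 * (x / 2) ^ Suc N *
      (real (Suc N) * bes_ser (Suc N) ((x / 2)\<^sup>2) - (x / 2)\<^sup>2 * bes_ser (Suc (Suc N)) ((x / 2)\<^sup>2))"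
    by (subst bes_ser_recurrence) simp
  also have "\<dots> = 2 * real (Suc N) * bes (Suc N) x - x * bes (Suc (Suc N)) x"
    by (simp add: bes_def algebra_simps power2_eq_square)
  finally show ?thesis by simp
qed

lemma xbes'_Suc: "xbes' (Suc N) x = x * bes N x - real (Suc N) * bes (Suc N) x"
  using bes_recurrence [of x N] by (simp add: xbes'_def algebra_simps)

lemma DERIV_bes:
  assumes "x > 0"
  shows "DERIV (bes N) x :> xbes' N x / x"
proof -
  have "DERIV (\<lambda>x. (x / 2) ^ N * bes_ser N ((x / 2)\<^sup>2)) x :>
     (real N * (x / 2) ^ (N - 1) / 2) * bes_ser N ((x / 2)\<^sup>2)
       + (x / 2) ^ N * (- bes_ser (Suc N) ((x / 2)\<^sup>2) * (x / 2))"
    by (auto intro!: derivative_eq_intros DERIV_chain2 [OF DERIV_bes_ser] simp: power2_eq_square)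
  also have "(real N * (x / 2) ^ (N - 1) / 2) * bes_ser N ((x / 2)\<^sup>2)
       + (x / 2) ^ N * (- bes_ser (Suc N) ((x / 2)\<^sup>2) * (x / 2)) = xbes' N x / x"
    using assms by (cases N) (simp_all add: xbes'_def bes_def field_simps)
  finally show ?thesis unfolding bes_def [abs_def] .
qed

text \<open>The Bessel equation as a first-order system for \<open>bes\<close> and
  \<open>xbes'\<close>. Differentiating \<open>N * bes N x - x * bes (Suc N) x\<close> brings in
  \<open>xbes' (Suc N)\<close>, which the recurrence turns back into order \<open>N\<close>.\<close>

lemma DERIV_xbes':
  assumes "x > 0"
  shows "DERIV (xbes' N) x :> ((real N)\<^sup>2 - x\<^sup>2) * bes N x / x"
proof -
  have "DERIV (\<lambda>x. real N * bes N x - x * bes (Suc N) x) x :>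
     real N * (xbes' N x / x) - (1 * bes (Suc N) x + xbes' (Suc N) x / x * x)"
    by (rule derivative_eq_intros DERIV_bes assms refl)+ simp
  also have "real N * (xbes' N x / x) - (1 * bes (Suc N) x + xbes' (Suc N) x / x * x)
     = ((real N)\<^sup>2 - x\<^sup>2) * bes N x / x"
    unfolding xbes'_Suc using assms
    by (simp add: xbes'_def power2_eq_square field_simps)
  finally show ?thesis unfolding xbes'_def [abs_def] .
qed

lemma continuous_on_bes_ser: "continuous_on S (bes_ser N)"
  by (meson DERIV_bes_ser DERIV_continuous_on DERIV_subset subset_UNIV)

lemma continuous_on_bes: "continuous_on S (bes N)"
  unfolding bes_def [abs_def]
  by (intro continuous_intros continuous_on_compose2 [OF continuous_on_bes_ser [of UNIV N]]) auto

lemma continuous_on_xbes': "continuous_on S (xbes' N)"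
  unfolding xbes'_def [abs_def] by (intro continuous_intros continuous_on_bes)

text \<open>The leading coefficient \<open>1 / fact N\<close> is positive. This fixes the sign from
  which the alternation at the zeros starts.\<close>

lemma bes_pos_near_0: "\<exists>e>0. \<forall>x. 0 < x \<and> x < e \<longrightarrow> bes N x > 0"
proof -
  have "isCont (\<lambda>x. bes_ser N ((x / 2)\<^sup>2)) 0"
    using continuous_on_compose2 [OF continuous_on_bes_ser [of UNIV N], of UNIV "\<lambda>x. (x / 2)\<^sup>2"]
    by (auto intro!: continuous_intros simp: continuous_on_eq_continuous_at)
  moreover have "bes_ser N 0 = 1 / fact N"
    using powser_zero [of "bes_coeff N"] by (simp add: bes_ser_def bes_coeff_def)
  ultimately have "(\<lambda>x. bes_ser N ((x / 2)\<^sup>2)) \<midarrow>0\<rightarrow> 1 / fact N"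
    by (simp add: isCont_def)
  then have "\<forall>\<^sub>F x in at 0. bes_ser N ((x / 2)\<^sup>2) > 0"
    by (rule order_tendstoD) simp
  then obtain e where "e > 0" "\<And>x. x \<noteq> 0 \<Longrightarrow> dist x 0 < e \<Longrightarrow> bes_ser N ((x / 2)\<^sup>2) > 0"
    unfolding eventually_at by blast
  then show ?thesis
    by (intro exI [of _ e]) (auto simp: bes_def)
qed

text \<open>\<open>u\<^sup>2 + u'\<^sup>2\<close> for \<open>u = sqrt x * J\<^sub>N\<close>, which satisfies \<open>u'' + (1 - (N\<^sup>2 - 1/4) / x\<^sup>2) u = 0\<close>.\<close>

definition bes_energy :: "nat \<Rightarrow> real \<Rightarrow> real"
  where "bes_energy N x = x * (bes N x)\<^sup>2 + (bes N x / 2 + xbes' N x)\<^sup>2 / x"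

text \<open>The main terms \<open>u * u'\<close> cancel, and only the perturbation
  \<open>((real N)\<^sup>2 - 1/4) / x\<^sup>2\<close> of the harmonic oscillator remains.\<close>

lemma DERIV_bes_energy:
  assumes "x > 0"
  shows "DERIV (bes_energy N) x :>
    2 * ((real N)\<^sup>2 - 1/4) * (bes N x * (bes N x / 2 + xbes' N x)) / x\<^sup>2"
  unfolding bes_energy_def [abs_def]
  using assms
  by (auto intro!: derivative_eq_intros DERIV_bes DERIV_xbes') (simp add: power2_eq_square field_simps)

lemma bes_energy_nonneg: "x > 0 \<Longrightarrow> bes_energy N x \<ge> 0"
  by (simp add: bes_energy_def)

text \<open>From \<open>2 * \<bar>u * v\<bar> \<le> u\<^sup>2 + v\<^sup>2\<close>. The relative
  change of the energy is thus of order \<open>1 / x\<^sup>2\<close>, integrable at infinity, which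
  is what a Gronwall argument requires.\<close>

lemma DERIV_bes_energy_bound:
  assumes "x > 0"
  shows "\<bar>2 * ((real N)\<^sup>2 - 1/4) * (bes N x * (bes N x / 2 + xbes' N x)) / x\<^sup>2\<bar>
    \<le> ((real N)\<^sup>2 + 1) * bes_energy N x / x\<^sup>2"
proof -
  define u v where "u = sqrt x * bes N x" and "v = (bes N x / 2 + xbes' N x) / sqrt x"
  have uv: "bes N x * (bes N x / 2 + xbes' N x) = u * v"
    using assms by (simp add: u_def v_def)
  have E: "bes_energy N x = u\<^sup>2 + v\<^sup>2"
    using assms by (simp add: u_def v_def bes_energy_def power_mult_distrib power_divide)
  have "2 * \<bar>u * v\<bar> \<le> u\<^sup>2 + v\<^sup>2"
    using sum_squares_bound [of "\<bar>u\<bar>" "\<bar>v\<bar>"] by (simp add: abs_mult)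
  moreover have "\<bar>(real N)\<^sup>2 - 1/4\<bar> \<le> (real N)\<^sup>2 + 1"
    by (auto simp: abs_le_iff add_increasing)
  ultimately have "\<bar>(real N)\<^sup>2 - 1/4\<bar> * (2 * \<bar>u * v\<bar>) \<le> ((real N)\<^sup>2 + 1) * bes_energy N x"
    unfolding E by (intro mult_mono) auto
  then have "\<bar>(real N)\<^sup>2 - 1/4\<bar> * (2 * \<bar>u * v\<bar>) / x\<^sup>2 \<le> ((real N)\<^sup>2 + 1) * bes_energy N x / x\<^sup>2"
    by (rule divide_right_mono) simp
  then show ?thesis
    unfolding uv abs_mult abs_divide by (simp add: ac_simps)
qed

text \<open>Gronwall with an integrating factor whose logarithmic derivative is
  \<open>- ((real N)\<^sup>2 + 1) / x\<^sup>2\<close>. It bounds the energy for all large arguments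
  by its value at 1.\<close>

lemma bes_energy_antimono:
  assumes "0 < x" "x \<le> y"
  shows "bes_energy N y * exp (((real N)\<^sup>2 + 1) / y) \<le> bes_energy N x * exp (((real N)\<^sup>2 + 1) / x)"
proof (rule DERIV_nonpos_imp_nonincreasing [OF assms(2)])
  fix t assume "x \<le> t" "t \<le> y"
  then have t: "t > 0" using assms by simp
  let ?c = "(real N)\<^sup>2 + 1"
  let ?D = "2 * ((real N)\<^sup>2 - 1/4) * (bes N t * (bes N t / 2 + xbes' N t)) / t\<^sup>2"
  have "DERIV (\<lambda>t. bes_energy N t * exp (?c / t)) t :>
     (?D - ?c * bes_energy N t / t\<^sup>2) * exp (?c / t)"
    using t by (auto intro!: derivative_eq_intros DERIV_bes_energy)
      (simp add: power2_eq_square field_simps)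
  moreover have "(?D - ?c * bes_energy N t / t\<^sup>2) * exp (?c / t) \<le> 0"
    using DERIV_bes_energy_bound [OF t, of N, THEN abs_le_D1] by (intro mult_nonpos_nonneg) auto
  ultimately show "\<exists>d. DERIV (\<lambda>t. bes_energy N t * exp (?c / t)) t :> d \<and> d \<le> 0" by blast
qed

text \<open>The reverse Gronwall bound: energy zero at one point forces energy zero at all earlier
  positive points. It takes the place of uniqueness for the differential equation.\<close>

lemma bes_energy_mono:
  assumes "0 < x" "x \<le> y"
  shows "bes_energy N x * exp (- ((real N)\<^sup>2 + 1) / x) \<le> bes_energy N y * exp (- ((real N)\<^sup>2 + 1) / y)"
proof (rule DERIV_nonneg_imp_nondecreasing [OF assms(2)])
  fix t assume "x \<le> t" "t \<le> y"
  then have t: "t > 0" using assms by simp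
  let ?c = "(real N)\<^sup>2 + 1"
  let ?D = "2 * ((real N)\<^sup>2 - 1/4) * (bes N t * (bes N t / 2 + xbes' N t)) / t\<^sup>2"
  have "DERIV (\<lambda>t. bes_energy N t * exp (- ?c / t)) t :>
     (?D + ?c * bes_energy N t / t\<^sup>2) * exp (- ?c / t)"
    using t by (auto intro!: derivative_eq_intros DERIV_bes_energy)
      (simp add: power2_eq_square field_simps)
  moreover have "(?D + ?c * bes_energy N t / t\<^sup>2) * exp (- ?c / t) \<ge> 0"
    using DERIV_bes_energy_bound [OF t, of N, THEN abs_le_D2] by (intro mult_nonneg_nonneg) auto
  ultimately show "\<exists>d. DERIV (\<lambda>t. bes_energy N t * exp (- ?c / t)) t :> d \<and> 0 \<le> d" by blast
qed

lemma bes_decay: "\<exists>C>0. \<forall>x\<ge>1. \<bar>bes N x\<bar> \<le> C / sqrt x"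
proof -
  \<comment> \<open>The summand 1 only makes the constant positive.\<close>
  define C where "C = sqrt (bes_energy N 1 * exp ((real N)\<^sup>2 + 1)) + 1"
  have "\<bar>bes N x\<bar> \<le> C / sqrt x" if "x \<ge> 1" for x
  proof -
    have "(sqrt x * bes N x)\<^sup>2 \<le> bes_energy N x"
      using that by (simp add: bes_energy_def power_mult_distrib)
    also have "\<dots> \<le> bes_energy N x * exp (((real N)\<^sup>2 + 1) / x)"
      using that bes_energy_nonneg [of x N] by (simp add: mult_le_cancel_left1)
    also have "\<dots> \<le> bes_energy N 1 * exp ((real N)\<^sup>2 + 1)"
      using bes_energy_antimono [of 1 x N] that by simp
    finally have "\<bar>sqrt x * bes N x\<bar> \<le> sqrt (bes_energy N 1 * exp ((real N)\<^sup>2 + 1))"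
      by (metis real_sqrt_abs real_sqrt_le_iff)
    then have "sqrt x * \<bar>bes N x\<bar> \<le> C"
      using that by (simp add: C_def abs_mult)
    then show ?thesis using that by (simp add: field_simps)
  qed
  moreover have "C > 0"
    using bes_energy_nonneg [of 1 N] by (simp add: C_def add_nonneg_pos)
  ultimately show ?thesis by blast
qed

text \<open>At a double zero the energy would vanish, hence also at every smaller positive argument,
  against positivity of \<open>bes N\<close> near 0.\<close>

lemma bes_simple_zero:
  assumes "z > 0" "bes N z = 0"
  shows "xbes' N z \<noteq> 0"
proof
  assume "xbes' N z = 0"
  then have E: "bes_energy N z = 0" using assms by (simp add: bes_energy_def)
  obtain e where e: "e > 0" "\<And>x. 0 < x \<Longrightarrow> x < e \<Longrightarrow> bes N x > 0"
    using bes_pos_near_0 by blast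
  define x where "x = min z (e / 2)"
  have x: "0 < x" "x \<le> z" "x < e" using assms e by (auto simp: x_def)
  have "bes_energy N x * exp (- ((real N)\<^sup>2 + 1) / x) \<le> 0"
    using bes_energy_mono [OF x(1,2), of N] E by simp
  then have "bes_energy N x \<le> 0" by (simp add: mult_le_0_iff)
  moreover have "bes_energy N x \<ge> x * (bes N x)\<^sup>2"
    using x by (simp add: bes_energy_def)
  moreover have "x * (bes N x)\<^sup>2 > 0" using e(2) [OF x(1,3)] x by simp
  ultimately show False by simp
qed

text \<open>Sturm comparison with \<open>sin ((x - b) / 2)\<close> on an interval of length \<open>2 \<pi>\<close>.\<close>

lemma bes_zero_beyond: "\<exists>x>a. bes N x = 0"
proof (rule ccontr)
  assume "\<not> (\<exists>x>a. bes N x = 0)"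
  then have nz: "\<And>x. x > a \<Longrightarrow> bes N x \<noteq> 0" by blast
  \<comment> \<open>For \<open>x\<close> beyond \<open>2 * N\<close> the squared frequency
    \<open>1 - (N\<^sup>2 - 1/4) / x\<^sup>2\<close> of \<open>u = sqrt x * bes N x\<close> exceeds
    1/4, that of the comparison function.\<close>
  define b where "b = max \<bar>a\<bar> (2 * real N) + 1"
  have b: "b > a" "b \<ge> 1" "b > 2 * real N" by (auto simp: b_def)
  obtain s where s: "s \<in> {1, -1 :: real}" "s * bes N b > 0"
    using nz [OF b(1)] by (cases "bes N b > 0") (auto simp: not_less le_less intro: that [of 1] that [of "-1"])
  have pos: "s * bes N x > 0" if "x \<ge> b" for x
  proof (rule ccontr)
    assume "\<not> s * bes N x > 0"
    then have "\<exists>y. b \<le> y \<and> y \<le> x \<and> s * bes N y = 0"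
      using s(2) that continuous_on_bes [of "{b..x}" N]
      by (intro IVT2') (auto intro!: continuous_intros)
    then show False using nz s b(1) by force
  qed
  \<comment> \<open>The Wronskian of \<open>s * u\<close> and the comparison sine. If
    \<open>s * u\<close> stayed positive, \<open>W\<close> would be nonincreasing, but the sine
    vanishes at both ends while the cosine goes from 1 to -1, so \<open>W\<close> would have to go
    from negative to positive.\<close>
  define W where "W x = s * ((bes N x / 2 + xbes' N x) / sqrt x * sin ((x - b) / 2)
      - sqrt x * bes N x * (cos ((x - b) / 2) / 2))" for x
  have dW: "\<exists>y. DERIV W x :> y \<and> y \<le> 0" if x: "b \<le> x" "x \<le> b + 2 * pi" for x
  proof -
    have x0: "x > 0" using b x by simp
    have sq: "sqrt x * sqrt x = x" using x0 by simp
    have du: "DERIV (\<lambda>x. sqrt x * bes N x) x :> (bes N x / 2 + xbes' N x) / sqrt x"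
      using x0 by (auto intro!: derivative_eq_intros DERIV_bes simp: field_simps)
    have dv: "DERIV (\<lambda>x. (bes N x / 2 + xbes' N x) / sqrt x) x :>
        (((real N)\<^sup>2 - 1/4) / x\<^sup>2 - 1) * (sqrt x * bes N x)"
    proof -
      define r where "r = sqrt x"
      have r: "x = r\<^sup>2" "r > 0" using x0 by (simp_all add: r_def)
      have "DERIV (\<lambda>x. (bes N x / 2 + xbes' N x) / sqrt x) x :>
        ((xbes' N x / x / 2 + ((real N)\<^sup>2 - x\<^sup>2) * bes N x / x) * r
          - (bes N x / 2 + xbes' N x) * (1 / (2 * r))) / (r * r)"
        unfolding r_def using x0
        by (intro DERIV_divide DERIV_add DERIV_cdivide DERIV_bes DERIV_xbes')
           (auto intro!: derivative_eq_intros simp: field_simps)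
      then show ?thesis
        unfolding r_def [symmetric]
        by (rule DERIV_cong) (use r in \<open>simp add: field_simps power2_eq_square\<close>)
    qed
    have "DERIV W x :> s * (((((real N)\<^sup>2 - 1/4) / x\<^sup>2 - 1) * (sqrt x * bes N x) * sin ((x - b) / 2)
         + cos ((x - b) / 2) / 2 * ((bes N x / 2 + xbes' N x) / sqrt x))
         - ((bes N x / 2 + xbes' N x) / sqrt x * (cos ((x - b) / 2) / 2)
         + - sin ((x - b) / 2) / 4 * (sqrt x * bes N x)))"
      unfolding W_def
      by (intro DERIV_cmult DERIV_diff DERIV_mult' du dv DERIV_mult) (auto intro!: derivative_eq_intros)
    also have "s * (((((real N)\<^sup>2 - 1/4) / x\<^sup>2 - 1) * (sqrt x * bes N x) * sin ((x - b) / 2)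
         + cos ((x - b) / 2) / 2 * ((bes N x / 2 + xbes' N x) / sqrt x))
         - ((bes N x / 2 + xbes' N x) / sqrt x * (cos ((x - b) / 2) / 2)
         + - sin ((x - b) / 2) / 4 * (sqrt x * bes N x)))
         = (((real N)\<^sup>2 - 1/4) / x\<^sup>2 - 3/4) * sqrt x * (s * bes N x) * sin ((x - b) / 2)"
      by (simp add: algebra_simps)
    finally have "DERIV W x :> (((real N)\<^sup>2 - 1/4) / x\<^sup>2 - 3/4) * sqrt x * (s * bes N x) * sin ((x - b) / 2)" .
    moreover have "(((real N)\<^sup>2 - 1/4) / x\<^sup>2 - 3/4) \<le> 0"
    proof -
      have "2 * real N \<le> x" using b x by simp
      then have "(2 * real N)\<^sup>2 \<le> x\<^sup>2" by (rule power_mono) simp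
      then have "(real N)\<^sup>2 - 1/4 \<le> 3/4 * x\<^sup>2"
        using zero_le_power2 [of x] unfolding power_mult_distrib power2_eq_square [of 2] by linarith
      then show ?thesis using x0 by (simp add: field_simps)
    qed
    moreover have "sin ((x - b) / 2) \<ge> 0"
      using x by (intro sin_ge_zero) auto
    moreover have "sqrt x * (s * bes N x) \<ge> 0"
      using pos [OF x(1)] x0 by simp
    ultimately show "\<exists>y. DERIV W x :> y \<and> y \<le> 0"
      by (metis mult.assoc mult_nonneg_nonneg mult_nonpos_nonneg)
  qed
  have "W (b + 2 * pi) \<le> W b"
    by (rule DERIV_nonpos_imp_nonincreasing) (use dW in auto)
  moreover have "W b = - (sqrt b * (s * bes N b) / 2)" "W (b + 2 * pi) = sqrt (b + 2 * pi) * (s * bes N (b + 2 * pi)) / 2"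
    by (simp_all add: W_def)
  moreover have "sqrt b * (s * bes N b) > 0" "sqrt (b + 2 * pi) * (s * bes N (b + 2 * pi)) > 0"
    using b(2) pos [of b] pos [of "b + 2 * pi"] pi_gt_zero add_pos_pos [of b "2 * pi"]
    by (auto intro!: mult_pos_pos [of "sqrt _"])
  ultimately show False by simp
qed

section \<open>Bessel zeros and Lommel integrals\<close>

lemma eps_cases: "eps m = 1 \<or> eps m = -1"
  by (auto simp: eps_def power_int_minus_one_minus power_int_def uminus_power_if)

lemma eps_square: "eps m * eps m = 1"
  using eps_cases [of m] by auto

lemma bessel_J_eq_bes: "bessel_J m x = eps m * bes (nat \<bar>m\<bar>) x"
proof -
  have "(\<Sum>j. (-1) ^ j / (fact j * fact (j + N)) * (x / 2) ^ (2 * j + N)) = bes N x" for N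
  proof -
    have "bes N x = (\<Sum>j. (x / 2) ^ N * (bes_coeff N j * ((x / 2)\<^sup>2) ^ j))"
      unfolding bes_def bes_ser_def by (rule suminf_mult [OF summable_bes_coeff, symmetric])
    then show ?thesis
      by (simp add: bes_coeff_def power_add power_mult mult.left_commute [of "(x / 2) ^ N"]
          mult.commute [of "(x / 2) ^ N"] mult.assoc times_divide_eq_left)
  qed
  then show ?thesis by (simp add: bessel_J_def)
qed

lemma bessel_J_eq_0_iff: "bessel_J m x = 0 \<longleftrightarrow> bes (nat \<bar>m\<bar>) x = 0"
  using eps_cases [of m] by (auto simp: bessel_J_eq_bes)

lemma bes_sign_right_of_zero:
  assumes "z > 0" "bes N z = 0" "s * xbes' N z > 0"
  shows "\<exists>e>0. \<forall>x. z < x \<and> x < z + e \<longrightarrow> s * bes N x > 0"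
proof -
  have "DERIV (\<lambda>x. s * bes N x) z :> s * (xbes' N z / z)"
    by (intro DERIV_cmult DERIV_bes assms)
  moreover have "s * (xbes' N z / z) > 0" using assms by simp
  ultimately obtain e where "e > 0" "\<And>h. h > 0 \<Longrightarrow> h < e \<Longrightarrow> s * bes N z < s * bes N (z + h)"
    by (metis DERIV_pos_inc_right)
  then show ?thesis
    using assms(2) by (intro exI [of _ e]) (auto, metis add_diff_cancel_left' diff_gt_0_iff_gt
      diff_less_eq mult_zero_right add.commute diff_add_cancel)
qed

text \<open>One step of the recursion defining \<open>bessel_zero\<close>. The sign \<open>s\<close>
  just right of \<open>a\<close> persists up to the next zero \<open>z\<close> by the intermediate
  value theorem, so the derivative there cannot have sign \<open>s\<close>; simplicity excludes
  zero.\<close>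

lemma bessel_zero_step:
  assumes "a \<ge> 0" "e > 0" and pos: "\<And>x. a < x \<Longrightarrow> x < a + e \<Longrightarrow> s * bes N x > 0"
    and z: "z = Inf {x. x > a \<and> bes N x = 0}"
  shows "z > 0 \<and> bes N z = 0 \<and> s * xbes' N z < 0"
proof -
  define S where "S = {x. x > a \<and> bes N x = 0}"
  \<comment> \<open>The condition \<open>x > a\<close> alone is not closed. The zero-free gap of
    length \<open>e\<close> replaces it by a closed one, so the infimum is attained.\<close>
  have S: "S = {a + e..} \<inter> {x. bes N x = 0}"
    using pos assms(2) by (force simp: S_def not_less intro: leI)
  have ne: "S \<noteq> {}" using bes_zero_beyond [of a N] by (auto simp: S_def)
  have bdd: "bdd_below S" by (auto simp: S)
  have "closed {x. bes N x = 0}"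
    by (intro closed_Collect_eq continuous_on_bes continuous_on_const)
  then have "closed S" unfolding S by (intro closed_Int closed_atLeast)
  then have zS: "z \<in> S"
    unfolding z S_def [symmetric] by (rule closed_contains_Inf [OF ne bdd])
  have z0: "z > a" "bes N z = 0" using zS by (auto simp: S_def)
  then have z1: "z > 0" using assms by simp
  have bet: "s * bes N x > 0" if "a < x" "x < z" for x
  proof (rule ccontr)
    assume c: "\<not> s * bes N x > 0"
    define y where "y = min x (a + e / 2)"
    have y: "a < y" "y \<le> x" "s * bes N y > 0"
      using that pos [of y] \<open>e > 0\<close> by (auto simp: y_def min_def)
    have "\<exists>t. y \<le> t \<and> t \<le> x \<and> s * bes N t = 0"
      using c y by (intro IVT2') (auto intro!: continuous_intros continuous_on_bes)
    then obtain t where t: "y \<le> t" "t \<le> x" "s * bes N t = 0" by blast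
    have "s \<noteq> 0" using y by auto
    then have "t \<in> S" using t y by (auto simp: S_def)
    then have "z \<le> t" unfolding z S_def [symmetric] by (rule cInf_lower [OF _ bdd])
    then show False using t that by simp
  qed
  have "\<not> s * xbes' N z > 0"
  proof
    assume "s * xbes' N z > 0"
    then have "s * (xbes' N z / z) > 0" using z1 by simp
    moreover have "DERIV (\<lambda>x. s * bes N x) z :> s * (xbes' N z / z)"
      by (intro DERIV_cmult DERIV_bes z1)
    ultimately obtain d where d: "d > 0" "\<And>h. h > 0 \<Longrightarrow> h < d \<Longrightarrow> s * bes N (z - h) < s * bes N z"
      by (metis DERIV_pos_inc_left)
    define h where "h = min (d / 2) ((z - a) / 2)"
    have "h > 0" "h < d" "z - h > a" using d z0 by (auto simp: h_def min_def field_simps)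
    then show False using d(2) [of h] bet [of "z - h"] z0 by simp
  qed
  moreover have "s * xbes' N z \<noteq> 0"
  proof -
    have "s \<noteq> 0" using pos [of "a + e / 2"] \<open>e > 0\<close> by auto
    then show ?thesis using bes_simple_zero [OF z1 z0(2)] by simp
  qed
  ultimately show ?thesis using z0 z1 by linarith
qed

text \<open>The sign of the derivative has to be carried through the induction: it supplies the sign
  right of one zero that is needed to reach the next. The first derivative is negative because
  \<open>bes\<close> starts out positive.\<close>

lemma bessel_zero_props:
  "bessel_zero m (Suc n) > 0 \<and> bes (nat \<bar>m\<bar>) (bessel_zero m (Suc n)) = 0 \<and>
   (-1) ^ Suc n * xbes' (nat \<bar>m\<bar>) (bessel_zero m (Suc n)) > 0"
proof (induction n)
  case 0
  obtain e where "e > 0" "\<And>x. 0 < x \<Longrightarrow> x < e \<Longrightarrow> bes (nat \<bar>m\<bar>) x > 0"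
    using bes_pos_near_0 by blast
  then show ?case
    using bessel_zero_step [of 0 e 1 "nat \<bar>m\<bar>", OF _ _ _ refl] by (simp add: bessel_J_eq_0_iff)
next
  case (Suc n)
  then obtain e where "e > 0" "\<And>x. bessel_zero m (Suc n) < x \<Longrightarrow>
      x < bessel_zero m (Suc n) + e \<Longrightarrow> (-1) ^ Suc n * bes (nat \<bar>m\<bar>) x > 0"
    using bes_sign_right_of_zero by meson
  then show ?case
    using Suc bessel_zero_step [of "bessel_zero m (Suc n)" e "(-1) ^ Suc n" "nat \<bar>m\<bar>", OF _ _ _ refl]
    by (simp add: bessel_J_eq_0_iff)
qed

lemma
  assumes "n \<ge> 1"
  shows bessel_zero_pos: "bessel_zero m n > 0"
    and bes_bessel_zero: "bes (nat \<bar>m\<bar>) (bessel_zero m n) = 0"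
    and xbes'_bessel_zero: "xbes' (nat \<bar>m\<bar>) (bessel_zero m n) = (-1) ^ n * \<bar>xbes' (nat \<bar>m\<bar>) (bessel_zero m n)\<bar>"
    and xbes'_bessel_zero_nz: "xbes' (nat \<bar>m\<bar>) (bessel_zero m n) \<noteq> 0"
proof -
  obtain n' where n: "n = Suc n'" using assms by (cases n) auto
  note p = bessel_zero_props [of m n', folded n]
  show "bessel_zero m n > 0" "bes (nat \<bar>m\<bar>) (bessel_zero m n) = 0" using p by auto
  show "xbes' (nat \<bar>m\<bar>) (bessel_zero m n) \<noteq> 0" using p by auto
  show "xbes' (nat \<bar>m\<bar>) (bessel_zero m n) = (-1) ^ n * \<bar>xbes' (nat \<bar>m\<bar>) (bessel_zero m n)\<bar>"
    using p by (cases "even n") (auto simp: n)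
qed

lemma deriv_bessel_J:
  assumes "x > 0"
  shows "deriv (bessel_J m) x = eps m * (xbes' (nat \<bar>m\<bar>) x / x)"
proof (rule DERIV_imp_deriv)
  have "bessel_J m = (\<lambda>x. eps m * bes (nat \<bar>m\<bar>) x)" by (simp add: bessel_J_eq_bes fun_eq_iff)
  then show "DERIV (bessel_J m) x :> eps m * (xbes' (nat \<bar>m\<bar>) x / x)"
    using DERIV_cmult [OF DERIV_bes [OF assms]] by simp
qed

text \<open>At a zero, \<open>xbes' N z\<close> equals both \<open>- z * bes (Suc N) z\<close> and,
  for positive \<open>N\<close>, \<open>z * bes (N - 1) z\<close>. The second form serves negative
  \<open>m\<close>, where passing to \<open>m + 1\<close> lowers the absolute order.\<close>

lemma abs_bessel_J_succ_at_zero: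
  assumes "bes (nat \<bar>m\<bar>) z = 0" "z > 0"
  shows "\<bar>bessel_J (m + 1) z\<bar> = \<bar>xbes' (nat \<bar>m\<bar>) z\<bar> / z"
proof (cases "m \<ge> 0")
  case True
  then have "nat \<bar>m + 1\<bar> = Suc (nat \<bar>m\<bar>)" by simp
  then have "bessel_J (m + 1) z = eps (m + 1) * bes (Suc (nat \<bar>m\<bar>)) z"
    by (simp only: bessel_J_eq_bes)
  then show ?thesis
    using assms eps_cases [of "m + 1"] by (auto simp: xbes'_def abs_mult)
next
  case False
  then have "nat \<bar>m\<bar> = Suc (nat \<bar>m + 1\<bar>)" by simp
  then obtain k where k: "nat \<bar>m\<bar> = Suc k" "nat \<bar>m + 1\<bar> = k" by blast
  then show ?thesis
    using assms eps_cases [of "m + 1"]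
    unfolding bessel_J_eq_bes abs_mult k by (auto simp: xbes'_Suc abs_mult)
qed

section \<open>Lommel integrals\<close>

lemma of_nat_times_bes_0 [simp]: "real N * bes N 0 = 0"
  by (cases "N = 0") (simp_all add: bes_def)

lemma xbes'_0 [simp]: "xbes' N 0 = 0"
  by (simp add: xbes'_def del: mult_eq_0_iff)

text \<open>The case \<open>a = 0\<close> is included because the frequency \<open>k = 0\<close>
  leads to it.\<close>

lemma DERIV_bes_scaled:
  assumes "a \<ge> 0" "r > 0"
  shows "DERIV (\<lambda>r. bes N (a * r)) r :> xbes' N (a * r) / r"
proof (cases "a = 0")
  case False
  then have "a * r > 0" using assms by simp
  then have "DERIV (bes N) (a * r) :> xbes' N (a * r) / (a * r)" by (rule DERIV_bes)
  from DERIV_chain2 [where g = "\<lambda>r. a * r", OF this, of a UNIV]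
  have "DERIV (\<lambda>r. bes N (a * r)) r :> xbes' N (a * r) / (a * r) * a"
    by (auto intro!: derivative_eq_intros)
  then show ?thesis by (rule DERIV_cong) (use assms False in \<open>simp add: field_simps\<close>)
qed simp

lemma DERIV_xbes'_scaled:
  assumes "a \<ge> 0" "r > 0"
  shows "DERIV (\<lambda>r. xbes' N (a * r)) r :> ((real N)\<^sup>2 - (a * r)\<^sup>2) * bes N (a * r) / r"
proof (cases "a = 0")
  case False
  then have "a * r > 0" using assms by simp
  then have "DERIV (xbes' N) (a * r) :> ((real N)\<^sup>2 - (a * r)\<^sup>2) * bes N (a * r) / (a * r)"
    by (rule DERIV_xbes')
  from DERIV_chain2 [where g = "\<lambda>r. a * r", OF this, of a UNIV]
  have "DERIV (\<lambda>r. xbes' N (a * r)) r :> ((real N)\<^sup>2 - (a * r)\<^sup>2) * bes N (a * r) / (a * r) * a"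
    by (auto intro!: derivative_eq_intros)
  then show ?thesis by (rule DERIV_cong) (use assms False in \<open>simp add: field_simps\<close>)
qed (use of_nat_times_bes_0 [of N] in \<open>auto simp: power2_eq_square simp del: of_nat_times_bes_0\<close>)

lemma continuous_on_bes_compose: "continuous_on S f \<Longrightarrow> continuous_on S (\<lambda>x. bes N (f x))"
  by (rule continuous_on_compose2 [OF continuous_on_bes [of UNIV]]) auto

lemma continuous_on_xbes'_compose: "continuous_on S f \<Longrightarrow> continuous_on S (\<lambda>x. xbes' N (f x))"
  by (rule continuous_on_compose2 [OF continuous_on_xbes' [of UNIV]]) auto

text \<open>The primitive is \<open>r (p q' - p' q)\<close> for \<open>p r = J\<^sub>N (a r)\<close> and \<open>q r = J\<^sub>N (b r)\<close>.\<close>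

lemma lommel_integral:
  assumes "a \<ge> 0" "b > 0" "a \<noteq> b" "bes N b = 0"
  shows "((\<lambda>r. r * bes N (a * r) * bes N (b * r)) has_integral
          bes N a * xbes' N b / (a\<^sup>2 - b\<^sup>2)) {0..1}"
proof -
  define D where "D r = bes N (a * r) * xbes' N (b * r) - xbes' N (a * r) * bes N (b * r)" for r
  have "((\<lambda>r. (a\<^sup>2 - b\<^sup>2) * (r * bes N (a * r) * bes N (b * r))) has_integral D 1 - D 0) {0..1}"
  proof (rule fundamental_theorem_of_calculus_interior)
    show "continuous_on {0..1} D" unfolding D_def
      by (intro continuous_intros continuous_on_bes_compose continuous_on_xbes'_compose)
  next
    fix r :: real assume "r \<in> {0<..<1}"
    then have r: "r > 0" by simp
    have "DERIV D r :> (bes N (a * r) * (((real N)\<^sup>2 - (b * r)\<^sup>2) * bes N (b * r) / r)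
         + xbes' N (a * r) / r * xbes' N (b * r))
         - (xbes' N (a * r) * (xbes' N (b * r) / r)
         + ((real N)\<^sup>2 - (a * r)\<^sup>2) * bes N (a * r) / r * bes N (b * r))"
      unfolding D_def using assms r
      by (intro DERIV_diff DERIV_mult' DERIV_bes_scaled DERIV_xbes'_scaled) auto
    then have "DERIV D r :> (a\<^sup>2 - b\<^sup>2) * (r * bes N (a * r) * bes N (b * r))"
      by (rule DERIV_cong) (use r in \<open>simp add: field_simps power2_eq_square\<close>)
    then show "(D has_vector_derivative (a\<^sup>2 - b\<^sup>2) * (r * bes N (a * r) * bes N (b * r))) (at r)"
      by (simp add: has_real_derivative_iff_has_vector_derivative)
  qed simp
  from has_integral_mult_right [OF this, of "1 / (a\<^sup>2 - b\<^sup>2)"]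
  have "((\<lambda>r. (1 / (a\<^sup>2 - b\<^sup>2)) * ((a\<^sup>2 - b\<^sup>2) * (r * bes N (a * r) * bes N (b * r)))) has_integral
      (1 / (a\<^sup>2 - b\<^sup>2)) * (bes N a * xbes' N b)) {0..1}"
    using assms by (simp add: D_def)
  moreover have "a\<^sup>2 - b\<^sup>2 \<noteq> 0" using assms by (simp add: power2_eq_iff)
  ultimately show ?thesis by simp
qed

text \<open>The primitive comes from multiplying the Bessel equation by \<open>2 * x * J'\<close>:
  the derivative of \<open>(x * J')\<^sup>2 + (x\<^sup>2 - N\<^sup>2) * J\<^sup>2\<close> is
  \<open>2 * x * J\<^sup>2\<close>.\<close>

lemma lommel_integral_diag:
  assumes "a > 0" "bes N a = 0"
  shows "((\<lambda>r. r * bes N (a * r) * bes N (a * r)) has_integral (xbes' N a)\<^sup>2 / (2 * a\<^sup>2)) {0..1}"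
proof -
  define G where "G r = ((xbes' N (a * r))\<^sup>2 + ((a * r)\<^sup>2 - (real N)\<^sup>2) * (bes N (a * r))\<^sup>2) / (2 * a\<^sup>2)" for r
  have "((\<lambda>r. r * bes N (a * r) * bes N (a * r)) has_integral G 1 - G 0) {0..1}"
  proof (rule fundamental_theorem_of_calculus_interior)
    show "continuous_on {0..1} G" unfolding G_def using assms
      by (intro continuous_intros continuous_on_bes_compose continuous_on_xbes'_compose) auto
  next
    fix r :: real assume "r \<in> {0<..<1}"
    then have r: "r > 0" by simp
    define p p' X' where "p = bes N (a * r)" and "p' = xbes' N (a * r)"
      and "X' = ((real N)\<^sup>2 - (a * r)\<^sup>2) * bes N (a * r) / r"
    have "DERIV (\<lambda>r. bes N (a * r)) r :> p' / r" "DERIV (\<lambda>r. xbes' N (a * r)) r :> X'"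
      using assms r by (auto simp: p'_def X'_def intro!: DERIV_bes_scaled DERIV_xbes'_scaled)
    then have "DERIV G r :> (2 * p' * X' + ((a * r)\<^sup>2 - (real N)\<^sup>2) * (2 * p * (p' / r)) + 2 * a\<^sup>2 * r * p\<^sup>2) / (2 * a\<^sup>2)"
      unfolding G_def using assms r
      by (auto intro!: derivative_eq_intros simp: p_def p'_def) (simp add: field_simps power2_eq_square power4_eq_xxxx)
    then have "DERIV G r :> r * bes N (a * r) * bes N (a * r)"
      by (rule DERIV_cong) (use r assms in \<open>simp add: field_simps power2_eq_square p_def p'_def X'_def\<close>)
    then show "(G has_vector_derivative r * bes N (a * r) * bes N (a * r)) (at r)"
      by (simp add: has_real_derivative_iff_has_vector_derivative)
  qed simp
  \<comment> \<open>This removes \<open>G 0\<close>: either \<open>N = 0\<close> or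
    \<open>bes N 0 = 0\<close>.\<close>
  moreover have "(real N)\<^sup>2 * (bes N 0)\<^sup>2 = 0"
    using of_nat_times_bes_0 [of N] by (simp add: power_mult_distrib [symmetric] del: mult_eq_0_iff)
  ultimately show ?thesis using assms by (simp add: G_def del: mult_eq_0_iff)
qed

text \<open>The two branches of \<open>bessel_quot\<close> are the off-diagonal and the diagonal
  Lommel integral. The two signs \<open>eps m\<close> in the integrand cancel; the explicit
  \<open>eps m\<close> on the right cancels the one inside \<open>bessel_quot\<close>.\<close>

lemma bessel_quot_integral:
  assumes "n \<ge> 1" "a \<ge> 0"
  shows "((\<lambda>r. r * bessel_J m (a * r) * bessel_J m (bessel_zero m n * r)) has_integral
     bessel_quot m n a * eps m * xbes' (nat \<bar>m\<bar>) (bessel_zero m n)) {0..1}"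
proof -
  define z N where "z = bessel_zero m n" and "N = nat \<bar>m\<bar>"
  have z: "z > 0" "bes N z = 0"
    using assms bessel_zero_pos bes_bessel_zero by (auto simp: z_def N_def)
  have "((\<lambda>r. r * bes N (a * r) * bes N (z * r)) has_integral
     bessel_quot m n a * eps m * xbes' N z) {0..1}"
  proof (cases "a = z")
    case True
    have "bessel_quot m n a * eps m * xbes' N z = (xbes' N a)\<^sup>2 / (2 * a\<^sup>2) * (eps m * eps m)"
      using True by (simp add: bessel_quot_def z_def [symmetric] deriv_bessel_J z N_def [symmetric] power2_eq_square ac_simps)
    then show ?thesis
      using lommel_integral_diag [of a N] True z by (simp add: eps_square)
  next
    case False
    have "bessel_quot m n a * eps m * xbes' N z = bes N a * xbes' N z / (a\<^sup>2 - z\<^sup>2) * (eps m * eps m)"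
      using False by (simp add: bessel_quot_def z_def [symmetric] bessel_J_eq_bes N_def)
    then show ?thesis
      using lommel_integral [of a z N] False z assms by (simp add: eps_square)
  qed
  moreover have "r * bessel_J m (a * r) * bessel_J m (z * r)
      = r * bes N (a * r) * bes N (z * r)" for r
    using eps_cases [of m] by (auto simp: bessel_J_eq_bes N_def)
  ultimately show ?thesis by (simp only: z_def N_def)
qed

section \<open>Fourier-Bessel coefficients of the Fourier modes\<close>

lemma has_integral_cis:
  fixes a b c \<phi> :: real
  assumes "a \<le> b" "c \<noteq> 0"
  shows "((\<lambda>t. cis (c * (t - \<phi>))) has_integral
    (cis (c * (b - \<phi>)) - cis (c * (a - \<phi>))) / (\<i> * of_real c)) {a..b}"
proof -
  let ?F = "\<lambda>t. cis (c * (t - \<phi>)) / (\<i> * of_real c)"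
  have "((\<lambda>t. cis (c * (t - \<phi>))) has_integral ?F b - ?F a) {a..b}"
  proof (rule fundamental_theorem_of_calculus [OF assms(1)])
    fix t :: real
    have "((\<lambda>z. exp (\<i> * of_real c * (z - of_real \<phi>)) / (\<i> * of_real c)) has_field_derivative
        exp (\<i> * of_real c * (of_real t - of_real \<phi>))) (at (of_real t))"
      using assms by (auto intro!: derivative_eq_intros)
    from has_vector_derivative_real_field [OF this]
    show "(?F has_vector_derivative cis (c * (t - \<phi>))) (at t within {a..b})"
      by (simp add: cis_conv_exp mult.assoc has_vector_derivative_at_within)
  qed
  then show ?thesis by (simp add: diff_divide_distrib)
qed

lemma has_integral_cis_multiple:
  "((\<lambda>\<theta>. cis (of_int q * (\<theta> - \<phi>))) has_integral (if q = 0 then 2 * pi else 0)) {0..2 * pi}"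
proof (cases "q = 0")
  case True
  then show ?thesis
    using has_integral_const_real [of "1 :: complex" 0 "2 * pi"] by (simp add: scaleR_conv_of_real)
next
  case False
  have "cis (of_int q * (2 * pi - \<phi>)) = cis (of_int q * (0 - \<phi>))"
    using cis_mult [of "2 * pi * of_int q" "of_int q * (0 - \<phi>)", symmetric] cis_multiple_2pi [of "of_int q"]
    by (simp add: algebra_simps)
  then show ?thesis
    using False has_integral_cis [of 0 "2 * pi" "of_int q" \<phi>] by simp
qed

text \<open>Binomial expansion of \<open>cis (s * u) + cis (- (s * u))\<close>. Taking
  \<open>s\<close> as the sign of the order lets one natural number \<open>M\<close> stand for both
  signs of \<open>m\<close>.\<close>

lemma two_cos_power_eq:
  fixes s u :: real and M P :: nat
  assumes "s \<in> {1, -1}"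
  shows "(2 * complex_of_real (cos u)) ^ P * cis (- (s * real M * u)) =
    (\<Sum>q\<le>P. of_nat (P choose q) * cis (s * (real P - 2 * real q - real M) * u))"
proof -
  have "2 * complex_of_real (cos u) = cis (- (s * u)) + cis (s * u)"
    using assms by (auto simp: complex_eq_iff)
  then have "(2 * complex_of_real (cos u)) ^ P =
      (\<Sum>q\<le>P. of_nat (P choose q) * cis (- (s * u)) ^ q * cis (s * u) ^ (P - q))"
    by (simp add: binomial_ring)
  then have "(2 * complex_of_real (cos u)) ^ P * cis (- (s * real M * u)) =
      (\<Sum>q\<le>P. of_nat (P choose q) *
        (cis (- (s * u)) ^ q * cis (s * u) ^ (P - q) * cis (- (s * real M * u))))"
    by (simp add: sum_distrib_right mult.assoc)
  also have "\<dots> = (\<Sum>q\<le>P. of_nat (P choose q) * cis (s * (real P - 2 * real q - real M) * u))"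
    by (intro sum.cong refl arg_cong2 [where f = "(*)"])
      (simp add: Complex.DeMoivre cis_mult of_nat_diff algebra_simps)
  finally show ?thesis .
qed

text \<open>Over a full period only the binomial term with \<open>P - 2 * q = M\<close> survives, so
  \<open>P\<close> must be \<open>M\<close> plus an even number; the binomial coefficient divided by
  \<open>fact P\<close> is then, up to sign, the Bessel coefficient.\<close>

lemma jacobi_anger_term:
  fixes x \<phi> :: real and m :: int
  defines "M \<equiv> nat \<bar>m\<bar>"
  shows "((\<lambda>\<theta>. (\<i> * of_real (x * cos (\<theta> - \<phi>))) ^ P /\<^sub>R fact P * cis (- (of_int m * (\<theta> - \<phi>)))) has_integral
    (if P \<in> range (\<lambda>q. M + 2 * q) then 2 * pi * \<i> ^ M * of_real (bes_coeff M ((P - M) div 2) * (x / 2) ^ P) else 0))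
    {0..2 * pi}"
proof -
  define s :: int where "s = (if m \<ge> 0 then 1 else -1)"
  have m: "m = s * int M" by (auto simp: s_def M_def)
  have s: "of_int s \<in> {1, -1 :: real}" by (simp add: s_def)
  have s0: "s \<noteq> 0" by (simp add: s_def)
  define c where "c = (\<i> * of_real (x / 2)) ^ P / fact P"
  have scale: "(A * B) /\<^sub>R r = A / of_real r * B" for A B :: complex and r
    by (simp add: scaleR_conv_of_real divide_inverse)
  have eq: "(\<i> * of_real (x * cos u)) ^ P /\<^sub>R fact P * cis (- (of_int m * u)) =
    (\<Sum>q\<le>P. c * of_nat (P choose q) * cis (of_int (s * (int P - 2 * int q - int M)) * u))" for u
  proof -
    have "\<i> * of_real (x * cos u) = (\<i> * of_real (x / 2)) * (2 * complex_of_real (cos u))"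
      by (simp add: complex_eq_iff)
    then have "(\<i> * of_real (x * cos u)) ^ P = ((\<i> * of_real (x / 2)) * (2 * complex_of_real (cos u))) ^ P"
      by (rule arg_cong)
    also have "\<dots> = (\<i> * of_real (x / 2)) ^ P * (2 * complex_of_real (cos u)) ^ P"
      by (rule power_mult_distrib)
    finally have "(\<i> * of_real (x * cos u)) ^ P /\<^sub>R fact P = c * (2 * complex_of_real (cos u)) ^ P"
      using scale [where r = "fact P"] by (simp only: c_def of_real_fact)
    then show ?thesis
      using two_cos_power_eq [OF s, of u P M]
      by (simp add: m mult.assoc sum_distrib_left)
  qed
  have "((\<lambda>\<theta>. \<Sum>q\<le>P. c * of_nat (P choose q) * cis (of_int (s * (int P - 2 * int q - int M)) * (\<theta> - \<phi>)))
      has_integral (\<Sum>q\<le>P. c * of_nat (P choose q) * (if s * (int P - 2 * int q - int M) = 0 then 2 * pi else 0))) {0..2 * pi}"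
    by (intro has_integral_sum has_integral_mult_right has_integral_cis_multiple) simp
  moreover have "(\<Sum>q\<le>P. c * of_nat (P choose q) * (if s * (int P - 2 * int q - int M) = 0 then 2 * pi else 0)) =
    (if P \<in> range (\<lambda>q. M + 2 * q) then 2 * pi * \<i> ^ M * of_real (bes_coeff M ((P - M) div 2) * (x / 2) ^ P) else 0)"
  proof (cases "P \<in> range (\<lambda>q. M + 2 * q)")
    case True
    then obtain k where k: "P = M + 2 * k" by blast
    have ii: "(\<i> ^ k)\<^sup>2 = (-1) ^ k" by (metis power2_i power_mult mult.commute)
    have "(\<Sum>q\<le>P. c * of_nat (P choose q) * (if s * (int P - 2 * int q - int M) = 0 then 2 * pi else 0))
      = (\<Sum>q\<le>P. if q = k then c * of_nat (P choose q) * (2 * pi) else 0)"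
      using s0 by (intro sum.cong) (auto simp: k)
    also have "\<dots> = c * of_nat (P choose k) * (2 * pi)" by (simp add: k)
    also have "of_nat (P choose k) = (fact P / (fact k * fact (k + M)) :: complex)"
      by (subst binomial_fact) (simp_all add: k add.commute)
    also have "c * (fact P / (fact k * fact (k + M))) * (2 * pi)
      = 2 * pi * \<i> ^ M * of_real (bes_coeff M k * (x / 2) ^ P)"
      by (simp add: c_def k bes_coeff_def power_add power_mult power_mult_distrib power_divide
          power_minus [of "(complex_of_real x)\<^sup>2 / 4"] ac_simps ii)
    finally show ?thesis using True k by simp
  next
    case False
    have "s * (int P - 2 * int q - int M) \<noteq> 0" for q
    proof
      assume "s * (int P - 2 * int q - int M) = 0"
      then have "P = M + 2 * q" using s0 by simp
      then show False using False by blast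
    qed
    then show ?thesis using False by simp
  qed
  ultimately show ?thesis unfolding eq by simp
qed

text \<open>The exponential series converges uniformly in the angle, dominated by the series of
  \<open>exp \<bar>x\<bar>\<close>, so it may be integrated term by term. Reindexing the surviving
  terms by \<open>M + 2 * q\<close> gives the Bessel series.\<close>

lemma jacobi_anger:
  fixes x \<phi> :: real and m :: int
  shows "((\<lambda>\<theta>. exp (\<i> * of_real (x * cos (\<theta> - \<phi>))) * cis (- (of_int m * (\<theta> - \<phi>)))) has_integral
    2 * pi * \<i> ^ nat \<bar>m\<bar> * of_real (bes (nat \<bar>m\<bar>) x)) {0..2 * pi}"
proof -
  define M where "M = nat \<bar>m\<bar>"
  define t where "t P \<theta> = (\<i> * of_real (x * cos (\<theta> - \<phi>))) ^ P /\<^sub>R fact P * cis (- (of_int m * (\<theta> - \<phi>)))" for P \<theta>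
  define I where "I P = (if P \<in> range (\<lambda>q. M + 2 * q) then 2 * pi * \<i> ^ M *
      of_real (bes_coeff M ((P - M) div 2) * (x / 2) ^ P) else 0)" for P
  have tI: "(t P has_integral I P) {0..2 * pi}" for P
    unfolding t_def I_def M_def by (rule jacobi_anger_term)
  have "uniform_limit {0..2 * pi} (\<lambda>n \<theta>. \<Sum>P<n. t P \<theta>) (\<lambda>\<theta>. \<Sum>P. t P \<theta>) sequentially"
  proof (rule Weierstrass_m_test)
    show "summable (\<lambda>n. inverse (fact n) * \<bar>x\<bar> ^ n)" by (rule summable_exp)
    fix n \<theta>
    have "\<bar>x * cos (\<theta> - \<phi>)\<bar> ^ n \<le> \<bar>x\<bar> ^ n"
      by (intro power_mono) (simp_all add: abs_mult mult_left_le)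
    then show "norm (t n \<theta>) \<le> inverse (fact n) * \<bar>x\<bar> ^ n"
      unfolding t_def norm_mult norm_power norm_scaleR norm_of_real norm_cis
      by (simp add: mult_left_mono)
  qed
  moreover have "(\<Sum>P. t P \<theta>) = exp (\<i> * of_real (x * cos (\<theta> - \<phi>))) * cis (- (of_int m * (\<theta> - \<phi>)))" for \<theta>
    unfolding t_def exp_def by (rule suminf_mult2 [symmetric]) (rule summable_exp_generic)
  ultimately have u: "uniform_limit {0..2 * pi} (\<lambda>n \<theta>. \<Sum>P<n. t P \<theta>)
      (\<lambda>\<theta>. exp (\<i> * of_real (x * cos (\<theta> - \<phi>))) * cis (- (of_int m * (\<theta> - \<phi>)))) sequentially" by simp
  have c: "continuous_on {0..2 * pi} (\<lambda>\<theta>. \<Sum>P<n. t P \<theta>)" for n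
    unfolding t_def by (intro continuous_intros)
  obtain I' J where
    I': "\<And>n. ((\<lambda>\<theta>. \<Sum>P<n. t P \<theta>) has_integral I' n) {0..2 * pi}"
    and J: "((\<lambda>\<theta>. exp (\<i> * of_real (x * cos (\<theta> - \<phi>))) * cis (- (of_int m * (\<theta> - \<phi>)))) has_integral J) {0..2 * pi}"
    and lim: "I' \<longlonglongrightarrow> J"
    by (rule uniform_limit_integral [OF u c sequentially_bot]) blast
  have "I' n = (\<Sum>P<n. I P)" for n
    by (rule has_integral_unique [OF I']) (intro has_integral_sum tI finite_lessThan)
  then have "I' = (\<lambda>n. \<Sum>P<n. I P)" by (rule ext)
  then have "I sums J" using lim unfolding sums_def by simp
  moreover have "I sums (2 * pi * \<i> ^ M * of_real (bes M x))"
  proof -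
    have "(\<lambda>q. 2 * pi * \<i> ^ M * of_real ((x / 2) ^ M * (bes_coeff M q * ((x / 2)\<^sup>2) ^ q))) sums
       (2 * pi * \<i> ^ M * of_real (bes M x))"
      unfolding bes_def bes_ser_def
      by (intro sums_mult sums_of_real summable_sums summable_bes_coeff)
    also have "(\<lambda>q. 2 * pi * \<i> ^ M * of_real ((x / 2) ^ M * (bes_coeff M q * ((x / 2)\<^sup>2) ^ q)))
       = (\<lambda>q. I (M + 2 * q))"
      by (simp add: I_def fun_eq_iff power_add power_mult)
    finally show ?thesis
      by (subst (asm) sums_mono_reindex) (auto simp: strict_mono_def I_def)
  qed
  ultimately show ?thesis using J sums_unique2 M_def by blast
qed

text \<open>For negative \<open>m\<close> the sign \<open>eps m\<close> turns
  \<open>(- \<i>) ^ nat \<bar>m\<bar>\<close> into \<open>\<i> ^ nat \<bar>m\<bar>\<close>, so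
  negative orders need no separate computation.\<close>

lemma i_powi_bessel_J:
  "\<i> powi m * of_real (bessel_J m x) = \<i> ^ nat \<bar>m\<bar> * of_real (bes (nat \<bar>m\<bar>) x)"
proof (cases "m \<ge> 0")
  case True
  then show ?thesis by (simp add: bessel_J_eq_bes eps_def power_int_def)
next
  case False
  define k where "k = nat (- m)"
  have "(- \<i>) ^ k * (-1) ^ k = \<i> ^ k" by (simp add: power_mult_distrib [symmetric])
  moreover have "(-1 :: real) powi m = (-1) ^ k"
    using False by (simp add: power_int_def k_def)
  ultimately show ?thesis
    using False by (simp add: bessel_J_eq_bes eps_def power_int_def k_def)
qed

definition fourier_mode :: "int \<times> int \<Rightarrow> real \<times> real \<Rightarrow> complex"
  where "fourier_mode k x = exp (\<i> * of_real (pi * (of_int (fst k) * fst x + of_int (snd k) * snd x)))"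

lemma fourier_mode_polar:
  "fourier_mode k (r * cos \<theta>, r * sin \<theta>) = exp (\<i> * of_real (pi * norm2 k * r * cos (\<theta> - polar_angle k)))"
proof -
  have c: "Complex (of_int (fst k)) (of_int (snd k)) = of_real (norm2 k) * cis (polar_angle k)"
    using rcis_cmod_Arg [of "Complex (of_int (fst k)) (of_int (snd k))"]
    by (simp add: rcis_def norm2_def polar_angle_def complex_norm)
  from arg_cong [OF c, of Re] arg_cong [OF c, of Im]
  have "of_int (fst k) = norm2 k * cos (polar_angle k)" "of_int (snd k) = norm2 k * sin (polar_angle k)"
    by simp_all
  then have "pi * (of_int (fst k) * (r * cos \<theta>) + of_int (snd k) * (r * sin \<theta>))
      = pi * norm2 k * r * cos (\<theta> - polar_angle k)"
    by (simp add: cos_diff algebra_simps)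
  then show ?thesis unfolding fourier_mode_def fst_conv snd_conv by (rule arg_cong)
qed

text \<open>\<open>cnj \<Psi>\<^sub>m\<^sub>n\<close> times the polar Jacobian, without the cut-off at \<open>r = 1\<close>.\<close>

definition polar_kernel :: "int \<Rightarrow> nat \<Rightarrow> real \<Rightarrow> real \<Rightarrow> complex"
  where "polar_kernel m n \<theta> r = exp (- (\<i> * of_int m * of_real \<theta>)) *
     of_real (r * bessel_J m (bessel_zero m n * r) / (sqrt pi * \<bar>bessel_J (m + 1) (bessel_zero m n)\<bar>))"

lemma cnj_Psi_eq_polar_kernel:
  assumes "r \<le> 1"
  shows "cnj (Psi m n r \<theta>) * of_real r = polar_kernel m n \<theta> r"
  using assms by (simp add: Psi_def polar_kernel_def exp_cnj)

lemma continuous_on_bessel_J_compose: "continuous_on S f \<Longrightarrow> continuous_on S (\<lambda>x. bessel_J m (f x))"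
  unfolding bessel_J_eq_bes by (intro continuous_intros continuous_on_bes_compose)

text \<open>By simplicity of the zeros. The normalising denominator of \<open>Psi\<close> is
  therefore a genuine nonzero constant.\<close>

lemma bessel_J_succ_at_zero_nz:
  assumes "n \<ge> 1"
  shows "bessel_J (m + 1) (bessel_zero m n) \<noteq> 0"
  using abs_bessel_J_succ_at_zero [OF bes_bessel_zero bessel_zero_pos, OF assms assms, of m]
    bessel_zero_pos [OF assms, of m] xbes'_bessel_zero_nz [OF assms, of m] by auto

lemma continuous_on_polar_kernel_compose:
  assumes "n \<ge> 1" "continuous_on S f" "continuous_on S g"
  shows "continuous_on S (\<lambda>x. polar_kernel m n (f x) (g x))"
  unfolding polar_kernel_def using assms bessel_J_succ_at_zero_nz [OF assms(1)]
  by (auto intro!: continuous_intros continuous_on_bessel_J_compose)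

lemma continuous_on_fourier_mode_compose:
  "continuous_on S f \<Longrightarrow> continuous_on S (\<lambda>x. fourier_mode k (f x))"
  unfolding fourier_mode_def by (intro continuous_intros)

text \<open>Jacobi-Anger evaluates the integral over the angle and Lommel the one over the radius.
  The factor 4 matches the Fourier series of \<open>4 * f\<close> on the square.\<close>

lemma c_coeff_eq_integral:
  assumes "n \<ge> 1"
  shows "integral {0..2 * pi} (\<lambda>\<theta>. integral {0..1} (\<lambda>r.
      fourier_mode k (r * cos \<theta>, r * sin \<theta>) * polar_kernel m n \<theta> r)) = 4 * c_coeff k m n"
proof -
  define z a \<phi> where "z = bessel_zero m n" and "a = pi * norm2 k" and "\<phi> = polar_angle k"
  define X where "X = xbes' (nat \<bar>m\<bar>) z"
  have z: "z > 0" "X \<noteq> 0" "X = (-1) ^ n * \<bar>X\<bar>"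
    using bessel_zero_pos [OF assms] xbes'_bessel_zero_nz [OF assms] xbes'_bessel_zero [OF assms]
    by (simp_all add: z_def X_def)
  have a: "a \<ge> 0" by (simp add: a_def norm2_def)
  have J: "\<bar>bessel_J (m + 1) z\<bar> = \<bar>X\<bar> / z"
    using abs_bessel_J_succ_at_zero [OF bes_bessel_zero bessel_zero_pos, OF assms assms, of m]
    by (simp add: z_def X_def)
  define E where "E = exp (- (\<i> * of_int m * of_real \<phi>))"
  have inner: "((\<lambda>\<theta>. fourier_mode k (r * cos \<theta>, r * sin \<theta>) * polar_kernel m n \<theta> r) has_integral
      2 * pi * \<i> powi m * E * of_real (z / (sqrt pi * \<bar>X\<bar>)) * of_real (r * bessel_J m (a * r) * bessel_J m (z * r))) {0..2 * pi}" for r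
  proof -
    have "((\<lambda>\<theta>. exp (\<i> * of_real (a * r * cos (\<theta> - \<phi>))) * cis (- (of_int m * (\<theta> - \<phi>))) *
        (E * of_real (z / (sqrt pi * \<bar>X\<bar>) * (r * bessel_J m (z * r))))) has_integral
      (2 * pi * \<i> ^ nat \<bar>m\<bar> * of_real (bes (nat \<bar>m\<bar>) (a * r))) *
        (E * of_real (z / (sqrt pi * \<bar>X\<bar>) * (r * bessel_J m (z * r))))) {0..2 * pi}"
      by (intro has_integral_mult_left jacobi_anger)
    moreover have "fourier_mode k (r * cos \<theta>, r * sin \<theta>) * polar_kernel m n \<theta> r =
        exp (\<i> * of_real (a * r * cos (\<theta> - \<phi>))) * cis (- (of_int m * (\<theta> - \<phi>))) *
        (E * of_real (z / (sqrt pi * \<bar>X\<bar>) * (r * bessel_J m (z * r))))" for \<theta>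
    proof -
      have "exp (- (\<i> * of_int m * of_real \<theta>)) = cis (- (of_int m * (\<theta> - \<phi>))) * E"
        by (simp add: E_def cis_conv_exp exp_add [symmetric] algebra_simps)
      moreover have "of_real (r * bessel_J m (z * r) / (sqrt pi * \<bar>bessel_J (m + 1) z\<bar>))
          = (of_real (z / (sqrt pi * \<bar>X\<bar>) * (r * bessel_J m (z * r))) :: complex)"
        by (simp add: J)
      ultimately show ?thesis
        unfolding fourier_mode_polar polar_kernel_def z_def [symmetric] a_def \<phi>_def
        by (simp only: mult.assoc)
    qed
    moreover have "(2 * pi * \<i> ^ nat \<bar>m\<bar> * of_real (bes (nat \<bar>m\<bar>) (a * r))) *
        (E * of_real (z / (sqrt pi * \<bar>X\<bar>) * (r * bessel_J m (z * r)))) =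
       2 * pi * \<i> powi m * E * of_real (z / (sqrt pi * \<bar>X\<bar>)) * of_real (r * bessel_J m (a * r) * bessel_J m (z * r))"
      using i_powi_bessel_J [of m "a * r"] by (simp add: ac_simps)
    ultimately show ?thesis by (simp only:)
  qed
  \<comment> \<open>The order of integration is exchanged so that the angle comes first, where
    Jacobi-Anger applies at each fixed radius.\<close>
  have "integral {0..2 * pi} (\<lambda>\<theta>. integral {0..1} (\<lambda>r.
      fourier_mode k (r * cos \<theta>, r * sin \<theta>) * polar_kernel m n \<theta> r))
    = integral {0..1} (\<lambda>r. integral {0..2 * pi} (\<lambda>\<theta>.
      fourier_mode k (r * cos \<theta>, r * sin \<theta>) * polar_kernel m n \<theta> r))"
    unfolding cbox_interval [symmetric]
    by (rule integral_swap_continuous)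
      (auto simp: case_prod_unfold intro!: continuous_intros continuous_on_fourier_mode_compose
        continuous_on_polar_kernel_compose assms)
  also have "\<dots> = integral {0..1} (\<lambda>r. 2 * pi * \<i> powi m * E * of_real (z / (sqrt pi * \<bar>X\<bar>)) *
      of_real (r * bessel_J m (a * r) * bessel_J m (z * r)))"
    by (intro integral_cong integral_unique inner)
  also have "\<dots> = 2 * pi * \<i> powi m * E * of_real (z / (sqrt pi * \<bar>X\<bar>)) *
      of_real (bessel_quot m n a * eps m * X)"
    using bessel_quot_integral [OF assms a, of m]
    by (intro integral_unique has_integral_mult_right has_integral_of_real)
      (simp add: z_def X_def)
  also have "\<dots> = 2 * (\<i> powi m * E) * of_real (pi * (z / (sqrt pi * \<bar>X\<bar>)) * (bessel_quot m n a * eps m * X))"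
    by (simp add: ac_simps)
  \<comment> \<open>Lommel's integral contributes \<open>X\<close> and the normalisation
    \<open>\<bar>X\<bar>\<close>; their quotient is the sign \<open>(-1) ^ n\<close>.\<close>
  also have "pi * (z / (sqrt pi * \<bar>X\<bar>)) * (bessel_quot m n a * eps m * X)
     = eps m * sqrt pi * (-1) ^ n * (z * bessel_quot m n a)"
  proof -
    have "pi * (z / (sqrt pi * Y)) * (q * (e * (t * Y))) = e * sqrt pi * t * (z * q)"
      if "Y > 0" for Y q e t :: real
    proof -
      have "pi / sqrt pi = sqrt pi" by (rule real_div_sqrt) simp
      then have "(pi / sqrt pi) * (z * q * e * t) = sqrt pi * (z * q * e * t)" by simp
      then show ?thesis using that by (simp add: ac_simps)
    qed
    from this [of "\<bar>X\<bar>" _ "eps m" "(-1) ^ n", folded z(3)] z(2) show ?thesis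
      by (simp add: mult.assoc)
  qed
  finally show ?thesis
    by (simp add: c_coeff_def z_def [symmetric] a_def \<phi>_def E_def)
qed

section \<open>Fourier inversion and quadrature in one variable\<close>

lemma jordan_sin_lower:
  fixes u :: real
  assumes "0 \<le> u" "u \<le> 1"
  shows "u \<le> sin (pi * u / 2)"
proof -
  have "convex_on {0..pi} (\<lambda>x. - sin x)"
    by (rule f''_ge0_imp_convex [where f' = "\<lambda>x. - cos x" and f'' = sin])
      (auto intro!: derivative_eq_intros sin_ge_zero)
  from convex_onD [OF this, of u 0 "pi / 2"] assms show ?thesis by (simp add: ac_simps)
qed

lemma norm_cis_minus_1: "norm (cis t - 1) = 2 * \<bar>sin (t / 2)\<bar>"
  using dist_exp_i_1 [of t] by (simp add: cis_conv_exp)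

text \<open>The bound must degenerate as \<open>d\<close> tends to 2, since
  \<open>cis (pi * s)\<close> returns to 1 at \<open>s = 2\<close>. Beyond 1 the symmetry of the
  sine under \<open>u\<close> to \<open>2 - u\<close> reduces to the chord bound.\<close>

lemma norm_cis_pi_minus_1_ge:
  fixes s d :: real
  assumes "\<bar>s\<bar> \<le> d" "d < 2"
  shows "norm (cis (pi * s) - 1) \<ge> (2 - d) * \<bar>s\<bar>"
proof -
  define u where "u = \<bar>s\<bar>"
  have u: "0 \<le> u" "u \<le> d" using assms by (auto simp: u_def)
  have "(2 - d) * u / 2 \<le> sin (pi * u / 2)"
  proof (cases "u \<le> 1")
    case True
    have "(2 - d) * u \<le> 2 * u" using u by (intro mult_right_mono) auto
    then show ?thesis using jordan_sin_lower [of u] True u by simp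
  next
    case False
    have "(2 - d) * u \<le> (2 - d) * 2" using u assms by (intro mult_left_mono) auto
    moreover have "2 - u \<le> sin (pi * (2 - u) / 2)"
      using False u assms by (intro jordan_sin_lower) auto
    moreover have "sin (pi * (2 - u) / 2) = sin (pi * u / 2)"
      by (simp add: right_diff_distrib diff_divide_distrib sin_diff)
    ultimately show ?thesis using u by simp
  qed
  moreover have "\<bar>sin (pi * s / 2)\<bar> \<ge> sin (pi * u / 2)"
    by (cases "s \<ge> 0") (auto simp: u_def)
  ultimately show ?thesis by (simp add: norm_cis_minus_1 u_def)
qed

section \<open>Cesaro means and pointwise Fourier inversion\<close>

lemma tendsto_cesaro_mean:
  fixes T :: "nat \<Rightarrow> 'a :: real_normed_vector"
  assumes "T \<longlonglongrightarrow> S"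
  shows "(\<lambda>M. (\<Sum>N<M. T N) /\<^sub>R real M) \<longlonglongrightarrow> S"
proof (rule tendstoI)
  fix e :: real assume e: "e > 0"
  then obtain N0 where N0: "\<And>N. N \<ge> N0 \<Longrightarrow> norm (T N - S) < e / 2"
    using assms by (metis LIMSEQ_iff half_gt_zero)
  define A where "A = (\<Sum>N<N0. norm (T N - S))"
  have "(\<lambda>M. A / real M) \<longlonglongrightarrow> 0" by (rule lim_const_over_n)
  then have "\<forall>\<^sub>F M in sequentially. A / real M < e / 2"
    using e by (intro order_tendstoD) auto
  moreover have "\<forall>\<^sub>F M in sequentially. M \<ge> max 1 N0" by (rule eventually_ge_at_top)
  ultimately show "\<forall>\<^sub>F M in sequentially. dist ((\<Sum>N<M. T N) /\<^sub>R real M) S < e"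
  proof eventually_elim
    case (elim M)
    then have M: "M > 0" "M \<ge> N0" by auto
    have "(\<Sum>N<M. T N) /\<^sub>R real M - S = (\<Sum>N<M. T N - S) /\<^sub>R real M"
      using M by (simp add: sum_subtractf scaleR_diff_right sum_constant_scaleR)
    then have "dist ((\<Sum>N<M. T N) /\<^sub>R real M) S = norm (\<Sum>N<M. T N - S) / real M"
      by (simp add: dist_norm divide_inverse ac_simps)
    also have "norm (\<Sum>N<M. T N - S) \<le> (\<Sum>N<M. norm (T N - S))" by (rule norm_sum)
    also have "\<dots> = A + (\<Sum>N=N0..<M. norm (T N - S))"
      unfolding A_def using M
      by (metis atLeast0LessThan le0 sum.atLeastLessThan_concat)
    also have "(\<Sum>N=N0..<M. norm (T N - S)) \<le> (\<Sum>N=N0..<M. e / 2)"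
      using N0 by (intro sum_mono less_imp_le) auto
    also have "(\<Sum>N=N0..<M. e / 2) \<le> real M * (e / 2)"
      using e by simp
    finally have "dist ((\<Sum>N<M. T N) /\<^sub>R real M) S \<le> (A + real M * (e / 2)) / real M"
      using M by (simp add: divide_right_mono)
    also have "\<dots> = A / real M + e / 2" using M by (simp add: field_simps)
    also have "\<dots> < e" using elim(1) by linarith
    finally show ?case .
  qed
qed

text \<open>The geometric sums are bounded independently of \<open>M\<close>, so division by
  \<open>M\<close> sends them to 0.\<close>

lemma cesaro_mean_cis:
  assumes "cis t \<noteq> 1"
  shows "(\<lambda>M. (\<Sum>N<M. cis (real N * t)) /\<^sub>R real M) \<longlonglongrightarrow> 0"
proof (rule Lim_null_comparison)
  show "\<forall>\<^sub>F M in sequentially. norm ((\<Sum>N<M. cis (real N * t)) /\<^sub>R real M) \<le> (2 / norm (cis t - 1)) / real M"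
  proof (rule always_eventually, rule allI)
    fix M
    have "(\<Sum>N<M. cis (real N * t)) = (cis t ^ M - 1) / (cis t - 1)"
      using geometric_sum [OF assms, of M] by (simp add: Complex.DeMoivre)
    moreover have "norm (cis t ^ M - 1) \<le> 2"
      using norm_triangle_ineq4 [of "cis t ^ M" 1] by (simp add: norm_power)
    ultimately have "norm (\<Sum>N<M. cis (real N * t)) \<le> 2 / norm (cis t - 1)"
      by (simp add: norm_divide divide_right_mono)
    then show "norm ((\<Sum>N<M. cis (real N * t)) /\<^sub>R real M) \<le> (2 / norm (cis t - 1)) / real M"
      by (simp add: divide_inverse mult.commute mult_left_mono)
  qed
  show "(\<lambda>M. (2 / norm (cis t - 1)) / real M) \<longlonglongrightarrow> 0" by (rule lim_const_over_n)
qed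

text \<open>Half-open ranges suit the telescoping \<open>w (k + 1) - w k\<close>: the sum from
  \<open>-N\<close> to \<open>N - 1\<close> leaves exactly \<open>w N - w (-N)\<close>.\<close>

lemma sum_atLeastLessThan_int_Suc:
  fixes d :: "int \<Rightarrow> 'a :: ab_group_add"
  shows "(\<Sum>k=-int (Suc N)..<int (Suc N). d k) = (\<Sum>k=-int N..<int N. d k) + d (int N) + d (- int N - 1)"
proof -
  have "{-int (Suc N)..<int (Suc N)} = insert (int N) (insert (- int N - 1) {-int N..<int N})" by auto
  then show ?thesis by (simp add: algebra_simps)
qed

lemma has_sum_int_delta:
  "((\<lambda>k :: int. if k = 0 then c else 0) has_sum (c :: 'a :: {topological_comm_monoid_add, t2_space})) UNIV"
  by (rule has_sum_finite_neutralI [of "{0}"]) auto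

text \<open>The symmetric ranges eventually contain every finite set of integers.\<close>

lemma has_sum_int_imp_LIMSEQ:
  fixes d :: "int \<Rightarrow> 'a :: {topological_comm_monoid_add}"
  assumes "(d has_sum S) UNIV"
  shows "(\<lambda>N. \<Sum>k=-int N..<int N. d k) \<longlonglongrightarrow> S"
proof -
  have "filterlim (\<lambda>N. {-int N..<int N}) (finite_subsets_at_top UNIV) sequentially"
    unfolding filterlim_finite_subsets_at_top
  proof (intro allI impI)
    fix X :: "int set" assume "finite X \<and> X \<subseteq> UNIV"
    then have X: "finite ((\<lambda>k. nat \<bar>k\<bar>) ` X)" by simp
    define N0 where "N0 = Suc (Max (insert 0 ((\<lambda>k. nat \<bar>k\<bar>) ` X)))"
    have "nat \<bar>k\<bar> < N0" if "k \<in> X" for k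
      unfolding N0_def using X that by (intro le_imp_less_Suc Max_ge) auto
    then have "X \<subseteq> {-int N..<int N}" if "N \<ge> N0" for N
      using that by fastforce
    then show "\<forall>\<^sub>F N in sequentially. finite {-int N..<int N} \<and> X \<subseteq> {-int N..<int N} \<and> {-int N..<int N} \<subseteq> UNIV"
      by (intro eventually_sequentiallyI [of N0]) auto
  qed
  with assms show ?thesis
    unfolding has_sum_def by (rule filterlim_compose)
qed

text \<open>Chernoff's argument: with \<open>w t = cis (- pi * (t - x))\<close> and \<open>f - f x = g * (w - 1)\<close>, the
  coefficients of \<open>f - f x\<close> about \<open>x\<close> telescope. As the partial sums are known to converge, their
  limit is that of their Cesaro means, which vanish by dominated convergence.\<close>

lemma fourier_inversion_1d:
  fixes f :: "real \<Rightarrow> complex"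
  assumes cont: "continuous_on UNIV f" and x: "- 1 < x" "x < 1"
    and lip: "\<And>t. t \<in> {-1..1} \<Longrightarrow> norm (f t - f x) \<le> M * \<bar>t - x\<bar>"
    and summ: "(\<lambda>k. norm (integral {-1..1} (\<lambda>t. f t * cis (- (pi * of_int k * t))))) summable_on (UNIV :: int set)"
  shows "((\<lambda>k. integral {-1..1} (\<lambda>t. f t * cis (- (pi * of_int k * t))) * cis (pi * of_int k * x))
    has_sum 2 * f x) UNIV"
proof -
  define a where "a k = integral {-1..1} (\<lambda>t. f t * cis (- (pi * of_int k * t)))" for k :: int
  define w where "w k t = cis (- (pi * of_int k * (t - x)))" for k :: int and t
  define g where "g t = (f t - f x) / (w 1 t - 1)" for t
  \<comment> \<open>Subtracting \<open>2 * f x\<close> at \<open>k = 0\<close> removes the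
    contribution of the constant \<open>f x\<close>; the \<open>d k\<close> belong to
    \<open>f - f x\<close>.\<close>
  define d where "d k = a k * cis (pi * of_int k * x) - (if k = 0 then 2 * f x else 0)" for k
  have M: "M \<ge> 0"
  proof (rule ccontr)
    assume "\<not> M \<ge> 0"
    then have "M * \<bar>1 - x\<bar> < 0" using x by (intro mult_neg_pos) auto
    then show False using lip [of 1] norm_ge_zero [of "f 1 - f x"] by simp
  qed
  \<comment> \<open>On the interval \<open>\<bar>t - x\<bar>\<close> is at most
    \<open>1 + \<bar>x\<bar>\<close>, and \<open>c\<close> is what remains up to 2, the next point
    where \<open>w 1 t\<close> would return to 1.\<close>
  define c where "c = 1 - \<bar>x\<bar>"
  have c: "c > 0" using x by (auto simp: c_def)
  have w1: "c * \<bar>t - x\<bar> \<le> norm (w 1 t - 1)" if "t \<in> {-1..1}" for t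
    using norm_cis_pi_minus_1_ge [of "- (t - x)" "1 + \<bar>x\<bar>"] that x
    by (auto simp: w_def c_def abs_minus_commute algebra_simps)
  have w1_eq: "w 1 t = 1 \<longleftrightarrow> t = x" if "t \<in> {-1..1}" for t
    using w1 [OF that] c by (auto simp: w_def mult_le_0_iff)
  \<comment> \<open>At \<open>t = x\<close> both sides are 0, division by zero giving
    \<open>g x = 0\<close>.\<close>
  have g_w: "g t * (w 1 t - 1) = f t - f x" if "t \<in> {-1..1}" for t
    using w1_eq [OF that] by (auto simp: g_def)
  have g_bound: "norm (g t) \<le> M / c" if "t \<in> {-1..1}" for t
  proof (cases "t = x")
    case False
    then have p: "c * \<bar>t - x\<bar> > 0" using c by simp
    have "norm (g t) = norm (f t - f x) / norm (w 1 t - 1)" by (simp add: g_def norm_divide)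
    also have "\<dots> \<le> (M * \<bar>t - x\<bar>) / (c * \<bar>t - x\<bar>)"
      using lip [OF that] w1 [OF that] p M by (intro frac_le) auto
    finally show ?thesis using False by simp
  qed (use M c in \<open>simp add: g_def\<close>)
  have [measurable]: "f \<in> borel_measurable borel"
    using cont by (rule borel_measurable_continuous_onI)
  have w_meas [measurable]: "w k \<in> borel_measurable borel" for k
    unfolding w_def by (intro borel_measurable_continuous_onI continuous_intros)
  have g_meas [measurable]: "g \<in> borel_measurable borel"
    unfolding g_def by measurable
  have gw_int: "set_integrable lborel {-1..1} (\<lambda>t. g t * w k t)" for k
    unfolding set_integrable_def
  proof (rule integrableI_bounded_set [where A = "{-1..1}" and B = "M / c"])
    show "AE t in lborel. t \<in> {-1..1} \<longrightarrow> norm (indicator {-1..1} t *\<^sub>R (g t * w k t)) \<le> M / c"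
      using g_bound by (auto simp: norm_mult w_def)
  qed (auto simp: indicator_def)
  have w_step: "(w 1 t - 1) * w k t = w (k + 1) t - w k t" for k t
    by (simp add: w_def left_diff_distrib cis_mult algebra_simps)
  have fw_int: "continuous_on {-1..1} (\<lambda>t. f t * cis (- (pi * of_int k * t)))" for k
    by (intro continuous_intros continuous_on_subset [OF cont]) auto
  have w_has_integral: "(w k has_integral (if k = 0 then 2 else 0)) {-1..1}" for k
  proof (cases "k = 0")
    case True
    then show ?thesis
      using has_integral_const_real [of "1 :: complex" "-1" 1] by (simp add: w_def [abs_def] scaleR_conv_of_real)
  next
    case False
    have "cis (- (pi * of_int k) * (1 - x)) = cis (- (pi * of_int k) * (- 1 - x))"
      using cis_mult [of "2 * pi * of_int (- k)" "- (pi * of_int k) * (- 1 - x)", symmetric]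
        cis_multiple_2pi [of "of_int (- k)"]
      by (simp add: algebra_simps)
    then show ?thesis
      using False has_integral_cis [of "-1" 1 "- (pi * of_int k)" x] by (simp add: w_def [abs_def])
  qed
  have d_eq: "d k = (LINT t:{-1..1}|lborel. g t * w (k + 1) t - g t * w k t)" for k
  proof -
    have "((\<lambda>t. f t * cis (- (pi * of_int k * t))) has_integral a k) {-1..1}"
      unfolding a_def by (intro integrable_integral integrable_continuous_real fw_int)
    then have "((\<lambda>t. f t * cis (- (pi * of_int k * t)) * cis (pi * of_int k * x) - f x * w k t) has_integral
        a k * cis (pi * of_int k * x) - f x * (if k = 0 then 2 else 0)) {-1..1}"
      by (intro has_integral_diff has_integral_mult_left has_integral_mult_right w_has_integral)
    moreover have "f t * cis (- (pi * of_int k * t)) * cis (pi * of_int k * x) - f x * w k t =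
       g t * w (k + 1) t - g t * w k t" if "t \<in> {-1..1}" for t
    proof -
      have "f t * cis (- (pi * of_int k * t)) * cis (pi * of_int k * x) - f x * w k t = (f t - f x) * w k t"
        by (simp add: w_def cis_mult algebra_simps)
      also have "\<dots> = g t * ((w 1 t - 1) * w k t)" using g_w [OF that] by (simp add: mult.assoc [symmetric])
      finally show ?thesis by (simp add: w_step right_diff_distrib)
    qed
    ultimately have "((\<lambda>t. g t * w (k + 1) t - g t * w k t) has_integral
        a k * cis (pi * of_int k * x) - f x * (if k = 0 then 2 else 0)) {-1..1}"
      by (rule has_integral_eq [rotated])
    moreover have "d k = a k * cis (pi * of_int k * x) - f x * (if k = 0 then 2 else 0)"
      by (simp add: d_def)
    ultimately have "((\<lambda>t. g t * w (k + 1) t - g t * w k t) has_integral d k) {-1..1}"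
      by (simp only:)
    moreover have "set_integrable lborel {-1..1} (\<lambda>t. g t * w (k + 1) t - g t * w k t)"
      by (intro set_integral_diff gw_int)
    ultimately show ?thesis
      by (metis integral_unique set_borel_integral_eq_integral(2))
  qed
  define T where "T N = (\<Sum>k=-int N..<int N. d k)" for N
  have T_eq: "T N = (LINT t:{-1..1}|lborel. g t * (w (int N) t - w (- int N) t))" for N
  proof (induction N)
    case (Suc N)
    have "T (Suc N) = T N + d (int N) + d (- int N - 1)"
      unfolding T_def by (rule sum_atLeastLessThan_int_Suc)
    also have "\<dots> = (LINT t:{-1..1}|lborel. (g t * (w (int N) t - w (- int N) t) +
        (g t * w (int N + 1) t - g t * w (int N) t)) + (g t * w (- int N - 1 + 1) t - g t * w (- int N - 1) t))"
      unfolding Suc d_eq using gw_int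
      by (simp add: set_integral_add set_integral_diff right_diff_distrib)
    also have "\<dots> = (LINT t:{-1..1}|lborel. g t * (w (int (Suc N)) t - w (- int (Suc N)) t))"
    proof -
      have "- int N - 1 + 1 = - int N" "int (Suc N) = int N + 1" "- (int N + 1) = - int N - 1" by simp_all
      moreover have "(p * (a - b) + (p * c - p * a)) + (p * b - p * d) = p * (c - d)" for p a b c d :: complex
        by (simp add: algebra_simps)
      ultimately show ?thesis by (simp only:)
    qed
    finally show ?case .
  qed (simp add: T_def)
  \<comment> \<open>Averaging is done inside the integral: the telescoped kernels only oscillate,
    but their means tend to 0 pointwise and stay bounded by 2.\<close>
  define D where "D m t = (\<Sum>N<m. w (int N) t - w (- int N) t) /\<^sub>R real m" for m t
  have mean: "(\<Sum>N<m. T N) /\<^sub>R real m = (LINT t:{-1..1}|lborel. g t * D m t)" for m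
  proof -
    have "(\<Sum>N<m. T N) = (LINT t:{-1..1}|lborel. (\<Sum>N<m. g t * (w (int N) t - w (- int N) t)))"
      unfolding T_eq set_lebesgue_integral_def scaleR_sum_right
      by (subst Bochner_Integration.integral_sum)
        (use gw_int in \<open>auto simp: set_integrable_def right_diff_distrib scaleR_diff_right\<close>)
    then show ?thesis
      unfolding set_lebesgue_integral_def D_def
      by (simp add: sum_distrib_left ac_simps flip: integral_scaleR_right)
  qed
  have D_meas: "D m \<in> borel_measurable borel" for m
    unfolding D_def [abs_def] w_def by (intro borel_measurable_continuous_onI continuous_intros)
  have D_bound: "norm (D m t) \<le> 2" for m t
  proof -
    have "norm (\<Sum>N<m. w (int N) t - w (- int N) t) \<le> (\<Sum>N<m. 2)"
      by (intro order_trans [OF norm_sum] sum_mono order_trans [OF norm_triangle_ineq4]) (simp add: w_def)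
    then show ?thesis by (cases "m = 0") (auto simp: D_def field_simps)
  qed
  have D_lim: "(\<lambda>m. D m t) \<longlonglongrightarrow> 0" if "t \<in> {-1..1}" "t \<noteq> x" for t
  proof -
    have c1: "cis (- (pi * (t - x))) \<noteq> 1" using w1_eq [OF that(1)] that(2) by (simp add: w_def)
    then have c2: "cis (pi * (t - x)) \<noteq> 1"
      by (metis cis_cnj complex_cnj_one_iff minus_minus)
    have "D m t = (\<Sum>N<m. cis (real N * (- (pi * (t - x))))) /\<^sub>R real m - (\<Sum>N<m. cis (real N * (pi * (t - x)))) /\<^sub>R real m" for m
      by (simp add: D_def w_def sum_subtractf scaleR_diff_right ac_simps)
    then show ?thesis
      using tendsto_diff [OF cesaro_mean_cis [OF c1] cesaro_mean_cis [OF c2]] by simp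
  qed
  have "(\<lambda>m. LINT t:{-1..1}|lborel. g t * D m t) \<longlonglongrightarrow> (LINT t:{-1..1::real}|lborel. (0 :: complex))"
    unfolding set_lebesgue_integral_def
  proof (rule integral_dominated_convergence [where w = "\<lambda>t::real. indicator {-1..1} t * (M / c * 2)"])
    show "integrable lborel (\<lambda>t::real. indicator {-1..1} t * (M / c * 2) :: real)"
      by (intro integrable_mult_left integrable_real_indicator) auto
    have lim0: "(\<lambda>m. indicator {-1..1} t *\<^sub>R (g t * D m t)) \<longlonglongrightarrow> indicator {-1..1} t *\<^sub>R 0" if "t \<noteq> x" for t
    proof (cases "t \<in> {-1..1}")
      case True
      from tendsto_mult_left [OF D_lim [OF this that], of "g t"] True show ?thesis by simp
    qed simp
    \<comment> \<open>The point \<open>t = x\<close>, to which \<open>cesaro_mean_cis\<close> does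
      not apply, is a null set.\<close>
    show "AE t in lborel. (\<lambda>m. indicator {-1..1} t *\<^sub>R (g t * D m t)) \<longlonglongrightarrow> indicator {-1..1} t *\<^sub>R 0"
      using AE_lborel_singleton [of x] by eventually_elim (rule lim0)
    show "AE t in lborel. norm (indicator {-1..1} t *\<^sub>R (g t * D m t)) \<le> indicator {-1..1} t * (M / c * 2)" for m
    proof (intro AE_I2)
      fix t
      have "norm (g t) * norm (D m t) \<le> M / c * 2" if "t \<in> {-1..1}"
        using M c by (intro mult_mono g_bound that D_bound) auto
      then show "norm (indicator {-1..1} t *\<^sub>R (g t * D m t)) \<le> indicator {-1..1} t * (M / c * 2)"
        by (simp add: indicator_def norm_mult)
    qed
    show "(\<lambda>t. indicator {-1..1} t *\<^sub>R (g t * D m t)) \<in> borel_measurable lborel" for m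
      by (intro borel_measurable_scaleR borel_measurable_indicator borel_measurable_times)
        (simp_all add: g_meas D_meas)
  qed simp
  then have mean0: "(\<lambda>m. (\<Sum>N<m. T N) /\<^sub>R real m) \<longlonglongrightarrow> 0"
    by (simp only: mean set_lebesgue_integral_def scaleR_zero_right Bochner_Integration.integral_zero)
  have delta: "((\<lambda>k :: int. if k = 0 then 2 * f x else 0) has_sum 2 * f x) UNIV"
    by (rule has_sum_int_delta)
  have "(\<lambda>k. a k * cis (pi * of_int k * x)) summable_on UNIV"
    using summ [folded a_def]
    by - (rule abs_summable_summable, simp only: norm_mult norm_cis mult_1_right)
  then obtain S where S: "((\<lambda>k. a k * cis (pi * of_int k * x)) has_sum S) UNIV"
    by (auto simp: summable_on_def)
  have "(d has_sum (S - 2 * f x)) UNIV"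
    using has_sum_add [OF S has_sum_uminusI [OF delta]] unfolding d_def [abs_def]
    by (simp only: diff_conv_add_uminus)
  then have "T \<longlonglongrightarrow> S - 2 * f x"
    unfolding T_def by (rule has_sum_int_imp_LIMSEQ)
  then have "S - 2 * f x = 0"
    using tendsto_cesaro_mean mean0 LIMSEQ_unique by blast
  then show ?thesis using S by (simp add: a_def)
qed

section \<open>Quadrature on the grid\<close>

lemma integral_cells:
  fixes h :: "real \<Rightarrow> 'a :: banach" and x :: "nat \<Rightarrow> real"
  assumes "mono x" "h integrable_on {x 0..x n}"
  shows "integral {x 0..x n} h = (\<Sum>i<n. integral {x i..x (Suc i)} h)"
  using assms(2)
proof (induction n)
  case (Suc n)
  have le: "x 0 \<le> x n" "x n \<le> x (Suc n)" using assms(1) by (auto intro: monoD)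
  have "h integrable_on {x 0..x n}"
    by (rule integrable_on_subinterval [OF Suc.prems]) (use le in auto)
  then show ?case
    using Suc.IH Henstock_Kurzweil_Integration.integral_combine [OF le Suc.prems] by simp
qed simp

text \<open>Comparing cell by cell costs \<open>O(M / L)\<close>; replacing the cell average of the exponential by its
  node value costs \<open>O(\<bar>k\<bar> / L)\<close> times the quadrature sum, and summation by parts bounds that sum
  by \<open>O(M / \<bar>k\<bar>)\<close>.\<close>

lemma quadrature_1d:
  fixes g :: "real \<Rightarrow> complex" and K :: nat and k :: int
  defines "L \<equiv> 2 * K + 1"
  assumes cont: "continuous_on {-1..1} g" and ends: "g (-1) = 0" "g 1 = 0"
    and lip: "\<And>s t. s \<in> {-1..1} \<Longrightarrow> t \<in> {-1..1} \<Longrightarrow> norm (g s - g t) \<le> M * \<bar>s - t\<bar>"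
    and k: "\<bar>k\<bar> \<le> int K"
  shows "norm (integral {-1..1} (\<lambda>t. g t * cis (- (pi * of_int k * t))) -
    of_real (2 / real L) * (\<Sum>i=1..L. g (grid_pt L i) * cis (- (pi * of_int k * grid_pt L i))))
    \<le> 6 * M * (2 / real L)"
proof -
  define \<delta> where "\<delta> = 2 / real L"
  have "L > 0" by (simp add: L_def)
  then have L: "L > 0" "real L * \<delta> = 2" by (simp_all add: \<delta>_def)
  have \<delta>: "\<delta> > 0" using L by (simp add: \<delta>_def)
  define x where "x i = -1 + real i * \<delta>" for i
  have x0: "x 0 = -1" and xL: "x L = 1" and xS: "x (Suc i) = x i + \<delta>" for i
    using L by (simp_all add: x_def algebra_simps)
  have mono: "mono x" using \<delta> by (auto simp: x_def mono_def intro!: mult_right_mono)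
  have x_in: "x i \<in> {-1..1}" if "i \<le> L" for i
    using monoD [OF mono, of 0 i] monoD [OF mono that] x0 xL by simp
  have M: "M \<ge> 0" using order_trans [OF norm_ge_zero lip [of 1 0]] by simp
  define c where "c = - (pi * of_int k)"
  define e where "e t = cis (c * t)" for t
  define \<omega> where "\<omega> = cis (c * \<delta>)"
  \<comment> \<open>The exact integral of the exponential over one cell relative to its value at the
    left node; it does not depend on the cell.\<close>
  define \<nu> where "\<nu> = (if k = 0 then of_real \<delta> else (\<omega> - 1) / (\<i> * of_real c))"
  define S where "S = (\<Sum>i<L. g (x i) * e (x i))"
  have e_step: "e (x (Suc i)) = e (x i) * \<omega>" for i
    by (simp add: e_def \<omega>_def xS cis_mult distrib_left)
  have cell: "((\<lambda>t. cis (c * (t - x i))) has_integral \<nu>) {x i..x (Suc i)}" for i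
  proof (cases "k = 0")
    case True
    then show ?thesis
      using has_integral_const_real [of "1 :: complex" "x i" "x (Suc i)"] \<delta>
      by (simp add: \<nu>_def c_def xS scaleR_conv_of_real)
  next
    case False
    then show ?thesis
      using has_integral_cis [of "x i" "x (Suc i)" c "x i"] \<delta> by (simp add: \<nu>_def c_def \<omega>_def xS)
  qed
  have \<nu>: "norm (\<nu> - of_real \<delta>) \<le> pi * \<bar>of_int k\<bar> * \<delta> * \<delta>"
  proof -
    have "((\<lambda>t. cis (c * (t - x 0)) - 1) has_integral \<nu> - of_real \<delta>) {x 0..x (Suc 0)}"
      using has_integral_const_real [of "1 :: complex" "x 0" "x (Suc 0)"] \<delta>
      by (intro has_integral_diff cell) (simp add: xS scaleR_conv_of_real)
    moreover have "norm (cis (c * (t - x 0)) - 1) \<le> pi * \<bar>of_int k\<bar> * \<delta>" if "t \<in> {x 0..x (Suc 0)}" for t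
    proof -
      have "norm (cis (c * (t - x 0)) - 1) \<le> \<bar>c * (t - x 0)\<bar>"
        using abs_sin_x_le_abs_x [of "c * (t - x 0) / 2"] by (simp add: norm_cis_minus_1)
      also have "\<dots> = pi * \<bar>of_int k\<bar> * \<bar>t - x 0\<bar>" by (simp add: c_def abs_mult)
      also have "\<dots> \<le> pi * \<bar>of_int k\<bar> * \<delta>"
        using that by (intro mult_left_mono) (auto simp: xS)
      finally show ?thesis .
    qed
    ultimately have "norm (\<nu> - of_real \<delta>) \<le> (pi * \<bar>of_int k\<bar> * \<delta>) * measure lborel {x 0..x (Suc 0)}"
      by (intro has_integral_bound_real [where S = "{}"]) (use \<delta> in auto)
    then show ?thesis using \<delta> by (simp add: xS)
  qed
  have S_bound: "norm S * (\<bar>of_int k\<bar> * \<delta>) \<le> M"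
  proof -
    \<comment> \<open>Shifting the index by one costs nothing because \<open>g\<close> vanishes at
      both end nodes.\<close>
    have "(\<Sum>i<L. g (x (Suc i)) * e (x (Suc i))) = S"
      using sum.lessThan_Suc_shift [of "\<lambda>i. g (x i) * e (x i)" L] ends x0 xL
      by (simp add: S_def)
    then have "S - S * \<omega> = (\<Sum>i<L. (g (x (Suc i)) - g (x i)) * e (x (Suc i)))"
      by (simp add: left_diff_distrib sum_subtractf) (simp add: S_def e_step sum_distrib_right mult.assoc)
    also have "norm \<dots> \<le> (\<Sum>i<L. M * \<delta>)"
    proof (intro order_trans [OF norm_sum] sum_mono)
      fix i assume "i \<in> {..<L}"
      then have "norm (g (x (Suc i)) - g (x i)) \<le> M * \<bar>x (Suc i) - x i\<bar>"
        by (intro lip x_in) auto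
      then show "norm ((g (x (Suc i)) - g (x i)) * e (x (Suc i))) \<le> M * \<delta>"
        using \<delta> by (simp add: norm_mult e_def xS)
    qed
    also have "\<dots> = 2 * M" using L by (simp add: mult.left_commute)
    finally have 1: "norm S * norm (\<omega> - 1) \<le> 2 * M"
      by (metis norm_minus_commute norm_mult right_diff_distrib mult.right_neutral)
    have "2 * (\<bar>of_int k\<bar> * \<delta>) \<le> norm (\<omega> - 1)"
    proof -
      \<comment> \<open>Here \<open>\<bar>k\<bar> \<le> K\<close> and the \<open>2 * K + 1\<close>
        nodes enter: the phase step stays within pi, so \<open>\<omega>\<close> is bounded away from
        1 proportionally to \<open>\<bar>k\<bar> * \<delta>\<close>.\<close>
      have "\<bar>real_of_int k\<bar> * \<delta> \<le> 1"
        using k by (simp add: \<delta>_def L_def field_simps)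
      then have "\<bar>of_int k\<bar> * \<delta> \<le> sin (pi * (\<bar>of_int k\<bar> * \<delta>) / 2)"
        using \<delta> by (intro jordan_sin_lower) auto
      also have "\<dots> \<le> \<bar>sin (c * \<delta> / 2)\<bar>"
        by (cases "k \<ge> 0") (auto simp: c_def ac_simps)
      finally show ?thesis by (simp add: \<omega>_def norm_cis_minus_1)
    qed
    then have "norm S * (2 * (\<bar>of_int k\<bar> * \<delta>)) \<le> norm S * norm (\<omega> - 1)"
      by (rule mult_left_mono) simp
    with 1 show ?thesis by simp
  qed
  have ge_cont: "continuous_on {-1..1} (\<lambda>t. g t * e t)"
    unfolding e_def by (intro continuous_intros cont)
  have sub: "{x i..x (Suc i)} \<subseteq> {-1..1}" if "i < L" for i
    using x_in [of i] x_in [of "Suc i"] that by auto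
  have cell_err: "norm (integral {x i..x (Suc i)} (\<lambda>t. g t * e t) - g (x i) * e (x i) * \<nu>) \<le> M * \<delta> * \<delta>"
    if i: "i < L" for i
  proof -
    have "((\<lambda>t. g t * e t - g (x i) * e (x i) * cis (c * (t - x i))) has_integral
       integral {x i..x (Suc i)} (\<lambda>t. g t * e t) - g (x i) * e (x i) * \<nu>) {x i..x (Suc i)}"
      by (intro has_integral_diff has_integral_mult_right cell integrable_integral
          integrable_continuous_real continuous_on_subset [OF ge_cont] sub i)
    moreover have "norm (g t * e t - g (x i) * e (x i) * cis (c * (t - x i))) \<le> M * \<delta>"
      if t: "t \<in> {x i..x (Suc i)}" for t
    proof -
      have "e (x i) * cis (c * (t - x i)) = e t" by (simp add: e_def cis_mult algebra_simps)
      then have "g t * e t - g (x i) * e (x i) * cis (c * (t - x i)) = (g t - g (x i)) * e t"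
        by (simp add: mult.assoc left_diff_distrib)
      then have "norm (g t * e t - g (x i) * e (x i) * cis (c * (t - x i))) = norm (g t - g (x i))"
        by (simp add: norm_mult e_def)
      also have "\<dots> \<le> M * \<bar>t - x i\<bar>" using t sub [OF i] x_in [of i] i by (intro lip) auto
      also have "\<dots> \<le> M * \<delta>" using t M by (intro mult_left_mono) (auto simp: xS)
      finally show ?thesis .
    qed
    ultimately have "norm (integral {x i..x (Suc i)} (\<lambda>t. g t * e t) - g (x i) * e (x i) * \<nu>)
        \<le> (M * \<delta>) * measure lborel {x i..x (Suc i)}"
      by (intro has_integral_bound_real [where S = "{}"]) (use \<delta> M in auto)
    then show ?thesis using \<delta> by (simp add: xS)
  qed
  define I where "I = integral {-1..1} (\<lambda>t. g t * e t)"
  have "I = (\<Sum>i<L. integral {x i..x (Suc i)} (\<lambda>t. g t * e t))"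
    using integral_cells [OF mono, of "\<lambda>t. g t * e t" L] ge_cont x0 xL
    by (simp add: I_def integrable_continuous_real)
  then have "I - S * \<nu> = (\<Sum>i<L. integral {x i..x (Suc i)} (\<lambda>t. g t * e t) - g (x i) * e (x i) * \<nu>)"
    by (simp add: S_def sum_subtractf sum_distrib_right)
  also have "norm \<dots> \<le> (\<Sum>i<L. M * \<delta> * \<delta>)"
    by (intro order_trans [OF norm_sum] sum_mono cell_err) auto
  also have "\<dots> = 2 * M * \<delta>" using L(2) by (simp add: mult.left_commute [of "real L"])
  finally have 1: "norm (I - S * \<nu>) \<le> 2 * M * \<delta>" .
  have "norm (S * (\<nu> - of_real \<delta>)) \<le> norm S * (pi * \<bar>of_int k\<bar> * \<delta> * \<delta>)"
    unfolding norm_mult by (intro mult_left_mono \<nu>) simp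
  also have "\<dots> = (norm S * (\<bar>of_int k\<bar> * \<delta>)) * (pi * \<delta>)" by (simp add: ac_simps)
  also have "\<dots> \<le> M * (pi * \<delta>)" using \<delta> by (intro mult_right_mono S_bound) auto
  \<comment> \<open>Bounding pi by 4 gives the total constant 6 = 2 + 4.\<close>
  also have "\<dots> \<le> M * (4 * \<delta>)" using M \<delta> pi_less_4 by (intro mult_left_mono mult_right_mono) auto
  finally have 2: "norm (S * (\<nu> - of_real \<delta>)) \<le> 4 * M * \<delta>" by simp
  have "norm (I - of_real \<delta> * S) = norm ((I - S * \<nu>) + S * (\<nu> - of_real \<delta>))"
    by (simp add: algebra_simps)
  also have "\<dots> \<le> 6 * M * \<delta>"
    using norm_triangle_ineq [of "I - S * \<nu>" "S * (\<nu> - of_real \<delta>)"] 1 2 by linarith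
  finally have "norm (I - of_real \<delta> * S) \<le> 6 * M * \<delta>" .
  \<comment> \<open>\<open>grid_pt\<close> counts from 1 and \<open>x\<close> from 0; the right end
    node belongs to neither sum.\<close>
  moreover have "S = (\<Sum>i=1..L. g (grid_pt L i) * cis (- (pi * of_int k * grid_pt L i)))"
    by (simp add: S_def sum.atLeast1_atMost_eq grid_pt_def x_def \<delta>_def e_def c_def)
  ultimately show ?thesis by (simp add: I_def e_def c_def \<delta>_def)
qed

section \<open>Fourier inversion and quadrature in the plane\<close>

text \<open>The continuous partial derivatives are bounded on the compact square; the sum of their
  bounds serves both variables.\<close>

lemma Cdiff_Suc_0_lipschitz:
  assumes "f \<in> Cdiff 1"
  obtains M where "M \<ge> 0"
    "\<And>x x' y. x \<in> {-1..1} \<Longrightarrow> x' \<in> {-1..1} \<Longrightarrow> y \<in> {-1..1} \<Longrightarrow> norm (f (x, y) - f (x', y)) \<le> M * \<bar>x - x'\<bar>"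
    "\<And>x y y'. x \<in> {-1..1} \<Longrightarrow> y \<in> {-1..1} \<Longrightarrow> y' \<in> {-1..1} \<Longrightarrow> norm (f (x, y) - f (x, y')) \<le> M * \<bar>y - y'\<bar>"
proof -
  obtain f1 f2 where c: "continuous_on UNIV f1" "continuous_on UNIV f2"
    and d1: "\<And>x y. ((\<lambda>s. f (s, y)) has_vector_derivative f1 (x, y)) (at x)"
    and d2: "\<And>x y. ((\<lambda>t. f (x, t)) has_vector_derivative f2 (x, y)) (at y)"
    using assms by auto
  have "\<exists>M\<ge>0. \<forall>p\<in>cbox (-1, -1) (1, 1). norm (h p) \<le> M" if "continuous_on UNIV h"
    for h :: "real \<times> real \<Rightarrow> complex"
  proof -
    have "bounded (h ` cbox (-1, -1) (1, 1))"
      by (intro compact_imp_bounded compact_continuous_image compact_cbox continuous_on_subset [OF that]) auto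
    then obtain M where "\<forall>p\<in>cbox (-1, -1) (1, 1). norm (h p) \<le> M" by (auto simp: bounded_iff)
    then show ?thesis by (meson max.cobounded2 max.coboundedI1)
  qed
  from this [OF c(1)] this [OF c(2)] obtain M1 M2 where
    M: "M1 \<ge> 0" "M2 \<ge> 0" "\<And>p. p \<in> cbox (-1, -1) (1, 1) \<Longrightarrow> norm (f1 p) \<le> M1"
      "\<And>p. p \<in> cbox (-1, -1) (1, 1) \<Longrightarrow> norm (f2 p) \<le> M2"
    by blast
  have lip: "norm (h s - h t) \<le> (M1 + M2) * \<bar>s - t\<bar>"
    if "s \<in> {-1..1}" "t \<in> {-1..1}" "\<And>u. (h has_vector_derivative h' u) (at u)"
      "\<And>u. u \<in> {-1..1} \<Longrightarrow> norm (h' u) \<le> M1 + M2" for s t :: real and h h' :: "real \<Rightarrow> complex"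
  proof -
    have "norm (h s - h t) \<le> (M1 + M2) * norm (s - t)"
    proof (rule differentiable_bound [where S = "{-1..1}" and f' = "\<lambda>u k. k *\<^sub>R h' u"])
      show "(h has_derivative (\<lambda>k. k *\<^sub>R h' u)) (at u within {-1..1})" for u
        using that(3) [of u] has_derivative_at_withinI by (auto simp: has_vector_derivative_def)
      show "onorm (\<lambda>k. k *\<^sub>R h' u) \<le> M1 + M2" if "u \<in> {-1..1}" for u
        using \<open>\<And>u. u \<in> {-1..1} \<Longrightarrow> norm (h' u) \<le> M1 + M2\<close> [OF that]
        by (intro onorm_le) (simp add: mult.commute mult_left_mono)
    qed (use that in auto)
    then show ?thesis by simp
  qed
  show ?thesis
  proof (rule that [of "M1 + M2"])
    show "0 \<le> M1 + M2" using M by simp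
    show "norm (f (x, y) - f (x', y)) \<le> (M1 + M2) * \<bar>x - x'\<bar>"
      if "x \<in> {-1..1}" "x' \<in> {-1..1}" "y \<in> {-1..1}" for x x' y
      by (rule lip [where h' = "\<lambda>u. f1 (u, y)"]) (use that d1 M in \<open>auto intro: add_increasing2\<close>)
    show "norm (f (x, y) - f (x, y')) \<le> (M1 + M2) * \<bar>y - y'\<bar>"
      if "x \<in> {-1..1}" "y \<in> {-1..1}" "y' \<in> {-1..1}" for x y y'
      by (rule lip [where h' = "\<lambda>u. f2 (x, u)"]) (use that d2 M in \<open>auto intro: add_increasing\<close>)
  qed
qed

text \<open>The transform in the second variable only. It lets the one-dimensional inversion and
  quadrature results be applied once per variable.\<close>

definition partial_fourier :: "(real \<times> real \<Rightarrow> complex) \<Rightarrow> int \<Rightarrow> real \<Rightarrow> complex"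
  where "partial_fourier f k x = integral {-1..1} (\<lambda>y. f (x, y) * cis (- (pi * of_int k * y)))"

lemma continuous_on_partial_fourier:
  assumes "continuous_on UNIV f"
  shows "continuous_on S (partial_fourier f k)"
proof -
  have "continuous_on UNIV (\<lambda>x. integral (cbox (-1) 1) (\<lambda>y. f (x, y) * cis (- (pi * of_int k * y))))"
    by (rule integral_continuous_on_param)
      (auto simp: case_prod_unfold intro!: continuous_intros continuous_on_compose2 [OF assms])
  then show ?thesis
    unfolding partial_fourier_def cbox_interval by (rule continuous_on_subset) simp
qed

lemma partial_fourier_lipschitz:
  assumes "continuous_on UNIV f" "\<And>y. y \<in> {-1..1} \<Longrightarrow> norm (f (x, y) - f (x', y)) \<le> M * \<bar>x - x'\<bar>"
  shows "norm (partial_fourier f k x - partial_fourier f k x') \<le> 2 * M * \<bar>x - x'\<bar>"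
proof -
  let ?e = "\<lambda>y. cis (- (pi * of_int k * y))"
  have i: "(\<lambda>y. f (x, y) * ?e y) integrable_on {-1..1}" for x
    by (intro integrable_continuous_real continuous_intros continuous_on_compose2 [OF assms(1)]) auto
  have "partial_fourier f k x - partial_fourier f k x' = integral {-1..1} (\<lambda>y. (f (x, y) - f (x', y)) * ?e y)"
    unfolding partial_fourier_def
    by (subst Henstock_Kurzweil_Integration.integral_diff [symmetric, OF i i]) (simp add: left_diff_distrib)
  also have "norm \<dots> \<le> (M * \<bar>x - x'\<bar>) * (1 - (-1))"
    by (rule integral_bound)
      (auto simp: norm_mult assms(2) intro!: continuous_intros continuous_on_compose2 [OF assms(1)])
  finally show ?thesis by simp
qed

text \<open>The disk lies in the square, so the integral over the plane is one over a box, and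
  continuity permits iterating it.\<close>

lemma fourier_coeff_iterated:
  assumes cont: "continuous_on UNIV f" and supp: "supp f \<subseteq> ball 0 1"
  shows "fourier_coeff f (k1, k2) = integral {-1..1} (\<lambda>x. partial_fourier f k2 x * cis (- (pi * of_int k1 * x)))"
proof -
  define h where "h p = f p * exp (- (\<i> * complex_of_real (pi * (of_int k1 * fst p + of_int k2 * snd p))))"
    for p :: "real \<times> real"
  let ?B = "cbox (-1, -1) (1, 1) :: (real \<times> real) set"
  have h_cont: "continuous_on S h" for S
    unfolding h_def by (intro continuous_intros continuous_on_subset [OF cont]) auto
  have h0: "h p = 0" if "p \<notin> ?B" for p
  proof -
    have "\<bar>fst p\<bar> \<le> norm p" "\<bar>snd p\<bar> \<le> norm p"
      using norm_fst_le [of "fst p" "snd p"] norm_snd_le [of "snd p" "fst p"] by simp_all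
    then have "norm p \<ge> 1" using that by (cases p) (auto simp: mem_box Basis_prod_def)
    then have "p \<notin> supp f" using supp by (auto simp: dist_norm)
    then show ?thesis by (simp add: h_def supp_def)
  qed
  have "fourier_coeff f (k1, k2) = (LINT p|lebesgue. h p)" by (simp add: fourier_coeff_def h_def)
  also have "\<dots> = (LINT p:?B|lebesgue. h p)"
    unfolding set_lebesgue_integral_def
    by (intro Bochner_Integration.integral_cong) (auto simp: indicator_def h0)
  also have "\<dots> = integral ?B h"
    by (intro set_lebesgue_integral_eq_integral absolutely_integrable_continuous h_cont)
  also have "\<dots> = integral (cbox (-1) 1) (\<lambda>x. integral (cbox (-1) 1) (\<lambda>y. h (x, y)))"
    by (rule integral_prod_continuous [OF h_cont])
  also have "(\<lambda>x. integral (cbox (-1) 1) (\<lambda>y. h (x, y)))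
      = (\<lambda>x. partial_fourier f k2 x * cis (- (pi * of_int k1 * x)))"
  proof
    fix x
    have "h (x, y) = f (x, y) * cis (- (pi * of_int k2 * y)) * cis (- (pi * of_int k1 * x))" for y
      by (simp add: h_def cis_conv_exp exp_add [symmetric] algebra_simps)
    then show "integral (cbox (-1) 1) (\<lambda>y. h (x, y)) = partial_fourier f k2 x * cis (- (pi * of_int k1 * x))"
      by (simp add: partial_fourier_def)
  qed
  finally show ?thesis by (simp only: cbox_interval)
qed

text \<open>One-dimensional inversion in \<open>x\<close>, then in \<open>y\<close>. The second use
  needs summability of \<open>partial_fourier f k2 x\<close> in \<open>k2\<close>; the first
  inversion supplies it, bounding this value by the row sum of the norms of the
  coefficients.\<close>

lemma fourier_inversion_2d:
  assumes cont: "continuous_on UNIV f" and supp: "supp f \<subseteq> ball 0 1"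
    and lip1: "\<And>x x' y. x \<in> {-1..1} \<Longrightarrow> x' \<in> {-1..1} \<Longrightarrow> y \<in> {-1..1} \<Longrightarrow> norm (f (x, y) - f (x', y)) \<le> M * \<bar>x - x'\<bar>"
    and lip2: "\<And>x y y'. x \<in> {-1..1} \<Longrightarrow> y \<in> {-1..1} \<Longrightarrow> y' \<in> {-1..1} \<Longrightarrow> norm (f (x, y) - f (x, y')) \<le> M * \<bar>y - y'\<bar>"
    and summ: "(\<lambda>k. norm (fourier_coeff f k)) summable_on UNIV"
    and x: "-1 < x" "x < 1" and y: "-1 < y" "y < 1"
  shows "((\<lambda>k. fourier_coeff f k * (cis (pi * of_int (fst k) * x) * cis (pi * of_int (snd k) * y)))
    has_sum 4 * f (x, y)) UNIV"
proof -
  \<comment> \<open>Indices are swapped so that the inner sum runs over the frequency in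
    \<open>x\<close>, which is inverted first.\<close>
  define a where "a = (\<lambda>(k2, k1). fourier_coeff f (k1, k2))"
  have a: "(\<lambda>k. norm (a k)) summable_on UNIV \<times> UNIV"
    using summable_on_swap [of "\<lambda>k. norm (fourier_coeff f k)" UNIV UNIV] summ
    by (simp add: a_def case_prod_unfold)
  then have a1: "(\<lambda>k1. norm (a (k2, k1))) summable_on UNIV" for k2
    using Infinite_Sum.abs_summable_on_Sigma_iff [of a UNIV "\<lambda>_. UNIV"] by auto
  have a2: "(\<lambda>k2. infsum (\<lambda>k1. norm (a (k2, k1))) UNIV) summable_on UNIV"
    using Infinite_Sum.abs_summable_on_Sigma_iff [of a UNIV "\<lambda>_. UNIV"] a infsum_nonneg [of UNIV "\<lambda>k1. norm (a (_, k1))"]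
    by (simp add: infsum_nonneg)
  have in1: "((\<lambda>k1. a (k2, k1) * cis (pi * of_int k1 * x)) has_sum 2 * partial_fourier f k2 x) UNIV" for k2
    using fourier_inversion_1d [of "partial_fourier f k2" x "2 * M"] a1 [of k2] x
      continuous_on_partial_fourier [OF cont] partial_fourier_lipschitz [OF cont lip1]
    by (simp add: a_def fourier_coeff_iterated [OF cont supp])
  have bd: "norm (2 * partial_fourier f k2 x) \<le> infsum (\<lambda>k1. norm (a (k2, k1))) UNIV" for k2
  proof (rule norm_has_sum_bound [OF _ in1])
    show "((\<lambda>k1. norm (a (k2, k1) * cis (pi * of_int k1 * x))) has_sum (\<Sum>\<^sub>\<infinity>k1. norm (a (k2, k1)))) UNIV"
      using a1 [of k2] by (simp add: norm_mult)
  qed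
  have pf: "(\<lambda>k2. norm (partial_fourier f k2 x)) summable_on UNIV"
  proof (rule summable_on_comparison_test [OF a2])
    show "norm (partial_fourier f k2 x) \<le> (\<Sum>\<^sub>\<infinity>k1. norm (a (k2, k1)))" for k2
      using bd [of k2] norm_ge_zero [of "partial_fourier f k2 x"] unfolding norm_mult norm_numeral by linarith
  qed auto
  have in2: "((\<lambda>k2. partial_fourier f k2 x * cis (pi * of_int k2 * y)) has_sum 2 * f (x, y)) UNIV"
    unfolding partial_fourier_def
  proof (rule fourier_inversion_1d)
    show "continuous_on UNIV (\<lambda>y. f (x, y))"
      by (intro continuous_on_compose2 [OF cont] continuous_intros) auto
    show "norm (f (x, t) - f (x, y)) \<le> M * \<bar>t - y\<bar>" if "t \<in> {-1..1}" for t
      using lip2 that x y by simp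
  qed (use y pf in \<open>auto simp: partial_fourier_def\<close>)
  let ?F = "\<lambda>k. a k * (cis (pi * of_int (snd k) * x) * cis (pi * of_int (fst k) * y))"
  have "((\<lambda>k2. 2 * partial_fourier f k2 x * cis (pi * of_int k2 * y)) has_sum 4 * f (x, y)) UNIV"
    using has_sum_cmult_right [OF in2, of 2] by (simp add: mult.assoc)
  moreover have "((\<lambda>k1. ?F (k2, k1)) has_sum 2 * partial_fourier f k2 x * cis (pi * of_int k2 * y)) UNIV" for k2
    using has_sum_cmult_left [OF in1 [of k2], of "cis (pi * of_int k2 * y)"] by (simp add: mult.assoc)
  moreover have "?F summable_on UNIV \<times> UNIV"
    by (rule abs_summable_summable) (use a in \<open>simp add: norm_mult\<close>)
  ultimately have "(?F has_sum 4 * f (x, y)) (UNIV \<times> UNIV)"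
    by (intro has_sum_SigmaI)
  then show ?thesis
    by (subst (asm) has_sum_swap) (simp add: a_def case_prod_unfold)
qed

text \<open>Quadrature in \<open>x\<close> of the partial transform, with Lipschitz constant
  \<open>2 * M\<close>, costs \<open>12 * M * \<delta>\<close>. Quadrature in \<open>y\<close> at
  each node costs \<open>6 * M * \<delta>\<close>, and the weights \<open>\<delta>\<close> of the
  \<open>L\<close> nodes add up to 2, giving another \<open>12 * M * \<delta>\<close>.\<close>

lemma finite_fourier_error:
  assumes cont: "continuous_on UNIV f" and supp: "supp f \<subseteq> ball 0 1"
    and lip1: "\<And>x x' y. x \<in> {-1..1} \<Longrightarrow> x' \<in> {-1..1} \<Longrightarrow> y \<in> {-1..1} \<Longrightarrow> norm (f (x, y) - f (x', y)) \<le> M * \<bar>x - x'\<bar>"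
    and lip2: "\<And>x y y'. x \<in> {-1..1} \<Longrightarrow> y \<in> {-1..1} \<Longrightarrow> y' \<in> {-1..1} \<Longrightarrow> norm (f (x, y) - f (x, y')) \<le> M * \<bar>y - y'\<bar>"
    and k: "\<bar>k1\<bar> \<le> int K" "\<bar>k2\<bar> \<le> int K"
  shows "norm (fourier_coeff f (k1, k2) - finite_fourier (2 * K + 1) f (k1, k2)) \<le> 48 * M / real (2 * K + 1)"
proof -
  define L where "L = 2 * K + 1"
  define \<delta> where "\<delta> = 2 / real L"
  have L: "L > 0" by (simp add: L_def)
  have \<delta>: "real L * \<delta> = 2" "\<delta> > 0" using L by (simp_all add: \<delta>_def)
  let ?e = "\<lambda>k t. cis (- (pi * of_int k * t))"
  have bdry: "f (s, t) = 0" if "\<bar>s\<bar> = 1 \<or> \<bar>t\<bar> = 1" for s t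
  proof -
    have "norm (s, t) \<ge> 1" using that norm_fst_le [of s t] norm_snd_le [of t s] by auto
    then have "(s, t) \<notin> supp f" using supp by (meson mem_ball_0 not_le subsetD)
    then show ?thesis by (simp add: supp_def)
  qed
  have grid: "grid_pt L i \<in> {-1..1}" if "i \<in> {1..L}" for i
    using that L by (auto simp: grid_pt_def field_simps)
  define G where "G i = of_real \<delta> * (\<Sum>j=1..L. f (grid_pt L i, grid_pt L j) * ?e k2 (grid_pt L j))" for i
  have e1: "norm (fourier_coeff f (k1, k2) - of_real \<delta> *
      (\<Sum>i=1..L. partial_fourier f k2 (grid_pt L i) * ?e k1 (grid_pt L i))) \<le> 6 * (2 * M) * \<delta>"
    unfolding fourier_coeff_iterated [OF cont supp] \<delta>_def L_def
  proof (rule quadrature_1d)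
    show "continuous_on {-1..1} (partial_fourier f k2)" by (rule continuous_on_partial_fourier [OF cont])
    show "partial_fourier f k2 (-1) = 0" "partial_fourier f k2 1 = 0"
      by (simp_all add: partial_fourier_def bdry)
    show "norm (partial_fourier f k2 s - partial_fourier f k2 t) \<le> 2 * M * \<bar>s - t\<bar>"
      if "s \<in> {-1..1}" "t \<in> {-1..1}" for s t
      by (rule partial_fourier_lipschitz [OF cont]) (rule lip1 [OF that])
  qed (rule k)
  have e2: "norm (partial_fourier f k2 (grid_pt L i) - G i) \<le> 6 * M * \<delta>" if "i \<in> {1..L}" for i
    unfolding G_def partial_fourier_def \<delta>_def L_def
  proof (rule quadrature_1d)
    show "continuous_on {-1..1} (\<lambda>y. f (grid_pt (2 * K + 1) i, y))"
      by (intro continuous_on_compose2 [OF cont] continuous_intros) auto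
    show "norm (f (grid_pt (2 * K + 1) i, s) - f (grid_pt (2 * K + 1) i, t)) \<le> M * \<bar>s - t\<bar>"
      if "s \<in> {-1..1}" "t \<in> {-1..1}" for s t
      using grid [OF \<open>i \<in> {1..L}\<close>] that unfolding L_def by (intro lip2)
  qed (simp_all add: bdry k)
  have "finite_fourier L f (k1, k2) = of_real \<delta> * (\<Sum>i=1..L. G i * ?e k1 (grid_pt L i))"
  proof -
    have "exp (- (complex_of_real pi * \<i> * complex_of_real (of_int k1 * s + of_int k2 * t))) = ?e k2 t * ?e k1 s" for s t
      by (simp add: cis_conv_exp exp_add [symmetric] algebra_simps)
    then show ?thesis
      by (simp add: finite_fourier_def G_def \<delta>_def [symmetric] power2_eq_square sum_distrib_left
          sum_distrib_right mult.assoc)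
  qed
  then have "of_real \<delta> * (\<Sum>i=1..L. partial_fourier f k2 (grid_pt L i) * ?e k1 (grid_pt L i)) - finite_fourier L f (k1, k2)
      = of_real \<delta> * (\<Sum>i=1..L. (partial_fourier f k2 (grid_pt L i) - G i) * ?e k1 (grid_pt L i))"
    by (simp add: left_diff_distrib sum_subtractf right_diff_distrib)
  also have "norm \<dots> \<le> \<delta> * (\<Sum>i=1..L. 6 * M * \<delta>)"
    unfolding norm_mult norm_of_real using \<delta>(2)
    by (intro mult_mono order_trans [OF norm_sum] sum_mono) (auto simp: norm_mult e2)
  also have "\<dots> = 12 * M * \<delta>" using \<delta>(1) by (simp add: mult.left_commute [of "real L"])
  finally have "norm (fourier_coeff f (k1, k2) - finite_fourier L f (k1, k2)) \<le> 6 * (2 * M) * \<delta> + 12 * M * \<delta>"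
    using e1 norm_triangle_le [of "_ - _" "_ - _"] by (meson norm_diff_triangle_le)
  also have "\<dots> = 48 * M / real L" by (simp add: \<delta>_def)
  finally show ?thesis by (simp only: L_def)
qed

section \<open>The Fourier-Bessel coefficient as a series\<close>

text \<open>The Fourier-Bessel functional in gauge-integral form. On continuous functions it agrees
  with \<open>fourier_bessel_coeff\<close>; the convergence proof uses its linearity, its sup-norm
  bound and its values on the Fourier modes.\<close>

definition polar_integral :: "int \<Rightarrow> nat \<Rightarrow> (real \<times> real \<Rightarrow> complex) \<Rightarrow> complex"
  where "polar_integral m n h = integral {0..2 * pi} (\<lambda>\<theta>. integral {0..1} (\<lambda>r.
     h (r * cos \<theta>, r * sin \<theta>) * polar_kernel m n \<theta> r))"

context
  fixes m :: int and n :: nat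
  assumes n: "n \<ge> 1"
begin

lemma continuous_on_polar_integrand:
  assumes "continuous_on UNIV h"
  shows "continuous_on S (\<lambda>p. h (snd p * cos (fst p), snd p * sin (fst p)) * polar_kernel m n (fst p) (snd p))"
  by (intro continuous_intros continuous_on_compose2 [OF assms] continuous_on_polar_kernel_compose n) auto

lemma continuous_on_polar_fibre:
  assumes "continuous_on UNIV h"
  shows "continuous_on {0..1} (\<lambda>r. h (r * cos \<theta>, r * sin \<theta>) * polar_kernel m n \<theta> r)"
  by (intro continuous_intros continuous_on_compose2 [OF assms] continuous_on_polar_kernel_compose n) auto

lemma continuous_on_polar_inner:
  assumes "continuous_on UNIV h"
  shows "continuous_on S (\<lambda>\<theta>. integral {0..1} (\<lambda>r. h (r * cos \<theta>, r * sin \<theta>) * polar_kernel m n \<theta> r))"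
  using integral_continuous_on_param [of S 0 1 "\<lambda>\<theta> r. h (r * cos \<theta>, r * sin \<theta>) * polar_kernel m n \<theta> r"]
    continuous_on_polar_integrand [OF assms]
  by (simp add: case_prod_unfold)

lemma fourier_bessel_coeff_eq_polar_integral:
  assumes cont: "continuous_on UNIV f"
  shows "fourier_bessel_coeff m n f = polar_integral m n f"
proof -
  have inner: "(LINT r:{0..1}|lebesgue. f (r * cos \<theta>, r * sin \<theta>) * cnj (Psi m n r \<theta>) * complex_of_real r) =
      integral {0..1} (\<lambda>r. f (r * cos \<theta>, r * sin \<theta>) * polar_kernel m n \<theta> r)" for \<theta>
  proof -
    have "(LINT r:{0..1}|lebesgue. f (r * cos \<theta>, r * sin \<theta>) * cnj (Psi m n r \<theta>) * complex_of_real r) =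
        (LINT r:{0..1}|lebesgue. f (r * cos \<theta>, r * sin \<theta>) * polar_kernel m n \<theta> r)"
      unfolding set_lebesgue_integral_def
      by (intro Bochner_Integration.integral_cong)
        (auto simp: indicator_def mult.assoc cnj_Psi_eq_polar_kernel)
    also have "\<dots> = integral {0..1} (\<lambda>r. f (r * cos \<theta>, r * sin \<theta>) * polar_kernel m n \<theta> r)"
      by (intro set_lebesgue_integral_eq_integral absolutely_integrable_continuous_real
          continuous_on_polar_fibre cont)
    finally show ?thesis .
  qed
  show ?thesis
    unfolding fourier_bessel_coeff_def polar_integral_def inner
    by (intro set_lebesgue_integral_eq_integral absolutely_integrable_continuous_real
        continuous_on_polar_inner cont)
qed

lemma polar_integral_diff:
  assumes "continuous_on UNIV g" "continuous_on UNIV h"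
  shows "polar_integral m n (\<lambda>p. g p - h p) = polar_integral m n g - polar_integral m n h"
  unfolding polar_integral_def left_diff_distrib
  by (simp add: Henstock_Kurzweil_Integration.integral_diff integrable_continuous_real
      continuous_on_polar_fibre continuous_on_polar_inner assms)

lemma polar_integral_sum:
  assumes "finite F" "\<And>k. k \<in> F \<Longrightarrow> continuous_on UNIV (h k)"
  shows "polar_integral m n (\<lambda>p. \<Sum>k\<in>F. h k p) = (\<Sum>k\<in>F. polar_integral m n (h k))"
  unfolding polar_integral_def sum_distrib_right
  by (simp add: Henstock_Kurzweil_Integration.integral_sum integrable_continuous_real
      continuous_on_polar_fibre continuous_on_polar_inner assms)

lemma polar_integral_mult_left:
  "polar_integral m n (\<lambda>p. c * h p) = c * polar_integral m n h"
  by (simp add: polar_integral_def mult.assoc)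

text \<open>The kernel is continuous on a compact rectangle. This is the continuity that lets the
  functional pass through a uniformly convergent series.\<close>

lemma polar_integral_bounded:
  obtains B where "B \<ge> 0"
    "\<And>h b. continuous_on UNIV h \<Longrightarrow> (\<And>p. p \<in> cball 0 1 \<Longrightarrow> norm (h p) \<le> b) \<Longrightarrow> norm (polar_integral m n h) \<le> B * b"
proof -
  have "bounded ((\<lambda>p. polar_kernel m n (fst p) (snd p)) ` ({0..2 * pi} \<times> {0..1}))"
    by (intro compact_imp_bounded compact_continuous_image compact_Times compact_Icc
        continuous_on_polar_kernel_compose continuous_intros n)
  then obtain B where B: "\<And>\<theta> r. \<theta> \<in> {0..2 * pi} \<Longrightarrow> r \<in> {0..1} \<Longrightarrow> norm (polar_kernel m n \<theta> r) \<le> B"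
    unfolding bounded_iff by fastforce
  have B0: "B \<ge> 0" using order_trans [OF norm_ge_zero B [of 0 0]] by simp
  show ?thesis
  proof (rule that [of "2 * pi * B"])
    fix h :: "real \<times> real \<Rightarrow> complex" and b
    assume h: "continuous_on UNIV h" and b: "\<And>p. p \<in> cball 0 1 \<Longrightarrow> norm (h p) \<le> b"
    have "norm (integral {0..1} (\<lambda>r. h (r * cos \<theta>, r * sin \<theta>) * polar_kernel m n \<theta> r)) \<le> b * B * (1 - 0)"
      if "\<theta> \<in> {0..2 * pi}" for \<theta>
    proof (rule integral_bound [OF _ continuous_on_polar_fibre [OF h]])
      fix r :: real assume r: "r \<in> {0..1}"
      have "(r * cos \<theta>)\<^sup>2 + (r * sin \<theta>)\<^sup>2 = r\<^sup>2"
        by (simp add: power_mult_distrib distrib_left [symmetric])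
      then have "(r * cos \<theta>, r * sin \<theta>) \<in> cball 0 1"
        using r by (simp add: norm_Pair)
      then show "norm (h (r * cos \<theta>, r * sin \<theta>) * polar_kernel m n \<theta> r) \<le> b * B"
        unfolding norm_mult using B [OF that r] b order_trans [OF norm_ge_zero b]
        by (intro mult_mono) auto
    qed simp
    then have "norm (polar_integral m n h) \<le> b * B * (2 * pi - 0)"
      unfolding polar_integral_def by (intro integral_bound continuous_on_polar_inner h) auto
    then show "norm (polar_integral m n h) \<le> 2 * pi * B * b" by (simp add: ac_simps)
  qed (use B0 in simp)
qed

lemma polar_integral_fourier_mode: "polar_integral m n (fourier_mode k) = 4 * c_coeff k m n"
  unfolding polar_integral_def by (rule c_coeff_eq_integral [OF n])

text \<open>The remainder \<open>R F\<close> of the Fourier series is bounded on the whole disk by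
  the tail of the sum of the norms, so its image under the bounded functional tends to 0 along
  finite sets \<open>F\<close>.\<close>

lemma has_sum_fourier_bessel_coeff:
  assumes cont: "continuous_on UNIV f"
    and summ: "(\<lambda>k. norm (fourier_coeff f k)) summable_on UNIV"
    and inv: "\<And>p. p \<in> ball 0 1 \<Longrightarrow> ((\<lambda>k. fourier_coeff f k * fourier_mode k p) has_sum 4 * f p) UNIV"
  shows "((\<lambda>k. c_coeff k m n * fourier_coeff f k) has_sum fourier_bessel_coeff m n f) UNIV"
proof -
  obtain B where B: "B \<ge> 0"
    "\<And>h b. continuous_on UNIV h \<Longrightarrow> (\<And>p. p \<in> cball 0 1 \<Longrightarrow> norm (h p) \<le> b) \<Longrightarrow> norm (polar_integral m n h) \<le> B * b"
    using polar_integral_bounded by blast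
  define a where "a k = fourier_coeff f k" for k
  define A where "A = infsum (\<lambda>k. norm (a k)) UNIV"
  have A: "((\<lambda>k. norm (a k)) has_sum A) UNIV" using summ by (simp add: A_def a_def)
  have norm_mode: "norm (fourier_mode k p) = 1" for k p
    by (simp add: fourier_mode_def)
  have mode_cont: "continuous_on UNIV (fourier_mode k)" for k
    using continuous_on_fourier_mode_compose [OF continuous_on_id] by simp
  define R where "R F p = 4 * f p - (\<Sum>k\<in>F. a k * fourier_mode k p)" for F p
  have R_cont: "continuous_on S (R F)" for F S
    unfolding R_def
    by (intro continuous_intros continuous_on_subset [OF cont] continuous_on_subset [OF mode_cont]) auto
  have R_bound: "norm (R F p) \<le> A - (\<Sum>k\<in>F. norm (a k))" if F: "finite F" and p: "p \<in> cball 0 1" for F p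
  \<comment> \<open>Inversion is assumed on the open disk only; continuity carries the bound to the
    closed one.\<close>
  proof (rule continuous_on_closure_norm_le [where f = "R F" and s = "ball 0 1" and x = p])
    show "\<forall>q\<in>ball 0 1. norm (R F q) \<le> A - (\<Sum>k\<in>F. norm (a k))"
    proof
      fix q :: "real \<times> real" assume q: "q \<in> ball 0 1"
      have "((\<lambda>k. a k * fourier_mode k q) has_sum R F q) (UNIV - F)"
        unfolding R_def a_def by (intro has_sum_Diff inv q has_sum_finite F) auto
      moreover have "((\<lambda>k. norm (a k * fourier_mode k q)) has_sum (A - (\<Sum>k\<in>F. norm (a k)))) (UNIV - F)"
        unfolding norm_mult norm_mode mult_1_right by (intro has_sum_Diff A has_sum_finite F) auto
      ultimately show "norm (R F q) \<le> A - (\<Sum>k\<in>F. norm (a k))"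
        by (rule norm_has_sum_bound [rotated])
    qed
  qed (use p R_cont in auto)
  define S where "S F = (\<Sum>k\<in>F. c_coeff k m n * a k)" for F
  have PS: "4 * (polar_integral m n f - S F) = polar_integral m n (R F)" if "finite F" for F
  proof -
    have "polar_integral m n (R F) = 4 * polar_integral m n f - (\<Sum>k\<in>F. a k * (4 * c_coeff k m n))"
      unfolding R_def
      by (subst polar_integral_diff, (intro continuous_intros cont mode_cont)+)
        (simp add: polar_integral_mult_left polar_integral_sum [OF that] polar_integral_fourier_mode
          continuous_on_mult continuous_on_const mode_cont)
    then show ?thesis by (simp add: S_def sum_distrib_left right_diff_distrib ac_simps)
  qed
  have "((\<lambda>F. polar_integral m n f - S F) \<longlongrightarrow> 0) (finite_subsets_at_top UNIV)"
  proof (rule Lim_null_comparison)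
    show "\<forall>\<^sub>F F in finite_subsets_at_top UNIV. norm (polar_integral m n f - S F) \<le> B * (A - (\<Sum>k\<in>F. norm (a k)))"
    proof (rule eventually_finite_subsets_at_top_weakI)
      fix F :: "(int \<times> int) set" assume F: "finite F"
      have "norm (polar_integral m n (R F)) \<le> B * (A - (\<Sum>k\<in>F. norm (a k)))"
        by (intro B R_cont R_bound F)
      then have "4 * norm (polar_integral m n f - S F) \<le> B * (A - (\<Sum>k\<in>F. norm (a k)))"
        unfolding PS [OF F, symmetric] norm_mult by simp
      then show "norm (polar_integral m n f - S F) \<le> B * (A - (\<Sum>k\<in>F. norm (a k)))"
        using norm_ge_zero [of "polar_integral m n f - S F"] by linarith
    qed
    have "((\<lambda>F. B * (A - (\<Sum>k\<in>F. norm (a k)))) \<longlongrightarrow> B * (A - A)) (finite_subsets_at_top UNIV)"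
      using A unfolding has_sum_def by (intro tendsto_intros)
    then show "((\<lambda>F. B * (A - (\<Sum>k\<in>F. norm (a k)))) \<longlongrightarrow> 0) (finite_subsets_at_top UNIV)" by simp
  qed
  from tendsto_diff [OF tendsto_const [of "polar_integral m n f"] this]
  have "(S \<longlongrightarrow> polar_integral m n f) (finite_subsets_at_top UNIV)" by simp
  then show ?thesis
    unfolding has_sum_def S_def [abs_def] a_def fourier_bessel_coeff_eq_polar_integral [OF cont] .
qed

end

section \<open>Decay of the coefficients and the error estimate\<close>

text \<open>A product majorant makes the lattice sum factor into two one-dimensional sums. The
  exponent is half of -5/4, the price of splitting \<open>1 + a + b\<close> into
  \<open>1 + a\<close> and \<open>1 + b\<close>; each factor still decays like
  \<open>\<bar>j\<bar>\<close> to the power -5/4, which is summable.\<close>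

definition decay :: "int \<Rightarrow> real"
  where "decay j = (1 + (of_int j)\<^sup>2) powr (-5/8)"

lemma decay_pos: "decay j > 0"
  using add_pos_nonneg [of 1 "(real_of_int j)\<^sup>2"] by (simp add: decay_def)

lemma decay_le_1: "decay j \<le> 1"
  using powr_mono2' [of "-5/8" 1 "1 + (real_of_int j)\<^sup>2"] by (simp add: decay_def)

lemma decay_summable: "decay summable_on UNIV"
proof -
  have "summable (\<lambda>i. decay (int i))"
  proof (rule summable_comparison_test_ev)
    show "summable (\<lambda>i. real i powr (-5/4))" by (subst summable_real_powr_iff) simp
    have "norm (decay (int i)) \<le> real i powr (-5/4)" if "i \<ge> 1" for i
    proof -
      have "decay (int i) \<le> ((real i)\<^sup>2) powr (-5/8)"
        unfolding decay_def using that by (intro powr_mono2') auto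
      also have "\<dots> = real i powr (-5/4)"
        using that powr_powr [of "real i" 2 "-5/8"] by (simp add: powr_numeral)
      finally show ?thesis using decay_pos [of "int i"] by simp
    qed
    then show "\<forall>\<^sub>F i in sequentially. norm (decay (int i)) \<le> real i powr (-5/4)"
      by (rule eventually_sequentiallyI)
  qed
  then have nat: "(\<lambda>i. decay (int i)) summable_on UNIV"
    by (rule summable_nonneg_imp_summable_on) (simp add: decay_pos less_imp_le)
  have "decay summable_on range int"
    using nat by (subst summable_on_reindex) (auto simp: o_def)
  moreover have "decay summable_on range (\<lambda>i. - int i)"
    using nat by (subst summable_on_reindex) (auto simp: o_def inj_on_def decay_def)
  ultimately have "decay summable_on (range int \<union> range (\<lambda>i. - int i))"
    by (rule summable_on_union)
  moreover have "range int \<union> range (\<lambda>i. - int i) = UNIV"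
    by (auto simp: image_iff) (metis int_cases2)
  ultimately show ?thesis by simp
qed

definition decay2 :: "int \<times> int \<Rightarrow> real"
  where "decay2 k = decay (fst k) * decay (snd k)"

lemma decay2_pos: "decay2 k > 0"
  by (simp add: decay2_def decay_pos)

lemma decay2_summable: "decay2 summable_on UNIV"
proof -
  have "decay2 summable_on (UNIV \<times> UNIV)"
  proof (rule summable_on_SigmaI)
    show "((\<lambda>j. decay2 (i, j)) has_sum decay i * infsum decay UNIV) UNIV" for i
      unfolding decay2_def fst_conv snd_conv
      by (intro has_sum_cmult_right has_sum_infsum decay_summable)
    show "(\<lambda>i. decay i * infsum decay UNIV) summable_on UNIV"
      by (intro summable_on_cmult_left decay_summable)
  qed (simp add: decay2_pos less_imp_le)
  then show ?thesis by simp
qed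

text \<open>The exponent -5/8 is relaxed to -1/2, which is all that a rate of \<open>1 / K\<close>
  asks for.\<close>

lemma decay_le_inverse:
  assumes "int K \<le> \<bar>j\<bar>" "K \<ge> 1"
  shows "decay j \<le> 1 / real K"
proof -
  have "decay j \<le> (1 + (real_of_int j)\<^sup>2) powr (-1/2)"
    unfolding decay_def by (intro powr_mono) auto
  also have "\<dots> \<le> ((real K)\<^sup>2) powr (-1/2)"
  proof (rule powr_mono2')
    have "real K \<le> \<bar>real_of_int j\<bar>" using assms(1) by linarith
    then have "(real K)\<^sup>2 \<le> \<bar>real_of_int j\<bar>\<^sup>2" by (intro power_mono) auto
    then show "(real K)\<^sup>2 \<le> 1 + (real_of_int j)\<^sup>2" by simp
  qed (use assms in auto)
  also have "\<dots> = 1 / real K"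
    using assms(2) by (simp add: powr_minus powr_half_sqrt inverse_eq_divide)
  finally show ?thesis .
qed

lemma decay2_le_inverse:
  assumes "\<not> max \<bar>fst k\<bar> \<bar>snd k\<bar> \<le> int K" "K \<ge> 1"
  shows "decay2 k \<le> 1 / real K"
proof -
  consider "int K \<le> \<bar>fst k\<bar>" | "int K \<le> \<bar>snd k\<bar>" using assms(1) by linarith
  then show ?thesis
  proof cases
    case 1
    have "decay2 k \<le> (1 / real K) * 1"
      unfolding decay2_def by (intro mult_mono decay_le_inverse decay_le_1 1 assms)
        (auto simp: decay_pos less_imp_le)
    then show ?thesis by simp
  next
    case 2
    have "decay2 k \<le> 1 * (1 / real K)"
      unfolding decay2_def by (intro mult_mono decay_le_inverse decay_le_1 2 assms)
        (auto simp: decay_pos less_imp_le)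
    then show ?thesis by simp
  qed
qed

text \<open>From \<open>(1 + a) * (1 + b) \<le> (1 + (a + b))\<^sup>2\<close> for nonnegative
  \<open>a\<close> and \<open>b\<close>, raised to the power -5/8.\<close>

lemma powr_norm2_le_decay2:
  "(1 + (norm2 k)\<^sup>2) powr (-5/4) \<le> decay2 k"
proof -
  define a b where "a = (real_of_int (fst k))\<^sup>2" and "b = (real_of_int (snd k))\<^sup>2"
  have ab: "a \<ge> 0" "b \<ge> 0" by (simp_all add: a_def b_def)
  have n: "(norm2 k)\<^sup>2 = a + b" by (simp add: norm2_def a_def b_def)
  have "(1 + (a + b)) powr (-5/4) = ((1 + (a + b)) powr 2) powr (-5/8)"
    by (simp add: powr_powr)
  also have "(1 + (a + b)) powr 2 = (1 + (a + b))\<^sup>2" using ab by (simp add: powr_numeral)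
  also have "((1 + (a + b))\<^sup>2) powr (-5/8) \<le> ((1 + a) * (1 + b)) powr (-5/8)"
  proof (rule powr_mono2')
    show "(1 + a) * (1 + b) \<le> (1 + (a + b))\<^sup>2"
      using ab by (simp add: power2_eq_square algebra_simps)
  qed (use ab in \<open>auto intro: mult_pos_pos\<close>)
  also have "\<dots> = decay2 k"
    using ab by (simp add: powr_mult decay2_def decay_def a_def b_def)
  finally show ?thesis by (simp add: n)
qed

section \<open>Size of the coefficients\<close>

lemma norm_c_coeff:
  "norm (c_coeff k m n) = sqrt pi / 2 * \<bar>bessel_zero m n\<bar> * \<bar>bessel_quot m n (pi * norm2 k)\<bar>"
proof -
  have "norm (exp (- (\<i> * of_int m * complex_of_real (polar_angle k)))) = 1"
    by (simp add: norm_exp_eq_Re)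
  moreover have "\<bar>eps m\<bar> = 1" using eps_cases [of m] by auto
  ultimately show ?thesis
    by (simp add: c_coeff_def norm_mult norm_power norm_power_int abs_mult)
qed

text \<open>Far out, the decay of the Bessel function (order -1/2) and the quadratic denominator
  combine to order -5/2. The finitely many remaining \<open>k\<close>, including any at the
  removable singularity, are absorbed into the constant.\<close>

lemma c_coeff_bound:
  "\<exists>A>0. \<forall>k. norm (c_coeff k m n) \<le> A * decay2 k"
proof -
  define z N where "z = bessel_zero m n" and "N = nat \<bar>m\<bar>"
  obtain C where C: "C > 0" "\<And>x. x \<ge> 1 \<Longrightarrow> \<bar>bes N x\<bar> \<le> C / sqrt x"
    using bes_decay by blast
  \<comment> \<open>From \<open>P\<close> on, \<open>norm2 k\<close> is at least 1 and at least
    \<open>\<bar>z\<bar>\<close>; then \<open>pi * norm2 k\<close> exceeds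
    \<open>\<bar>z\<bar>\<close>, and the denominator dominates the square of
    \<open>norm2 k\<close>.\<close>
  define P where "P = \<lceil>\<bar>z\<bar>\<rceil> + 1"
  have P: "real_of_int P \<ge> \<bar>z\<bar> + 1" "P \<ge> 1" unfolding P_def by linarith+
  define D where "D = sqrt pi / 2 * \<bar>z\<bar>"
  have D: "D \<ge> 0" by (simp add: D_def)
  have far: "norm (c_coeff k m n) \<le> (4 * D * C) * decay2 k" if k: "norm2 k \<ge> real_of_int P" for k
  proof -
    define s where "s = norm2 k"
    have s: "s \<ge> 1" "s \<ge> \<bar>z\<bar>" using k P by (simp_all add: s_def)
    have "2 * s \<le> pi * s" using s pi_gt3 by (intro mult_right_mono) auto
    with s have ps: "pi * s \<ge> 1" "pi * s \<ge> s" "pi * s \<ge> 2 * s" "pi * s > \<bar>z\<bar>"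
      by linarith+
    have den: "s\<^sup>2 \<le> (pi * s)\<^sup>2 - z\<^sup>2"
    proof -
      have "z\<^sup>2 \<le> s\<^sup>2" using s(2) by (metis abs_ge_zero power2_abs power_mono)
      moreover have "(2 * s)\<^sup>2 \<le> (pi * s)\<^sup>2" using ps s by (intro power_mono) auto
      moreover have "(2 * s)\<^sup>2 = 4 * s\<^sup>2" by (simp add: power_mult_distrib)
      ultimately show ?thesis using zero_le_power2 [of s] by linarith
    qed
    have num: "\<bar>bessel_J m (pi * s)\<bar> \<le> C / sqrt s"
    proof -
      have "\<bar>bessel_J m (pi * s)\<bar> = \<bar>bes N (pi * s)\<bar>"
        using eps_cases [of m] by (auto simp: bessel_J_eq_bes N_def)
      also have "\<dots> \<le> C / sqrt (pi * s)" by (rule C(2) [OF ps(1)])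
      also have "\<dots> \<le> C / sqrt s" using C(1) s ps by (intro divide_left_mono) auto
      finally show ?thesis .
    qed
    have "\<bar>bessel_quot m n (pi * s)\<bar> = \<bar>bessel_J m (pi * s)\<bar> / \<bar>(pi * s)\<^sup>2 - z\<^sup>2\<bar>"
      using ps(4) by (auto simp: bessel_quot_def z_def)
    also have "\<dots> \<le> (C / sqrt s) / s\<^sup>2"
      using num den s C(1) by (intro frac_le) auto
    also have "\<dots> = C * (s\<^sup>2) powr (-5/4)"
    proof -
      have "(s\<^sup>2) powr (-5/4) = s powr (- (1/2) - 2)"
        using s powr_powr [of s 2 "-5/4"] by (simp add: powr_numeral)
      also have "\<dots> = s powr (- (1/2)) / s powr 2" by (rule powr_diff)
      also have "\<dots> = 1 / sqrt s / s\<^sup>2"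
        using s by (simp add: powr_minus powr_half_sqrt powr_numeral inverse_eq_divide)
      finally show ?thesis by simp
    qed
    \<comment> \<open>Since \<open>s \<ge> 1\<close>, half of \<open>1 + s\<^sup>2\<close> is at
      most \<open>s\<^sup>2\<close>. The resulting factor \<open>2 powr (5/4)\<close> is the origin
      of the 4 in the constant.\<close>
    also have "(s\<^sup>2) powr (-5/4) \<le> ((1 + s\<^sup>2) * (1 / 2)) powr (-5/4)"
      using s by (intro powr_mono2') (auto simp: add_pos_nonneg one_le_power)
    also have "\<dots> = (1 + s\<^sup>2) powr (-5/4) * 2 powr (5/4)"
      by (simp add: powr_mult powr_divide powr_minus inverse_eq_divide)
    also have "\<dots> \<le> decay2 k * 4"
    proof (intro mult_mono)
      show "(1 + s\<^sup>2) powr (-5/4) \<le> decay2 k" unfolding s_def by (rule powr_norm2_le_decay2)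
      have "(2 :: real) powr (5/4) \<le> 2 powr 2" by (rule powr_mono) auto
      then show "(2 :: real) powr (5/4) \<le> 4" by (simp add: powr_numeral)
    qed (auto simp: decay2_pos less_imp_le)
    finally have "\<bar>bessel_quot m n (pi * s)\<bar> \<le> C * (decay2 k * 4)"
      using C(1) by (simp add: mult_left_mono)
    then have "D * \<bar>bessel_quot m n (pi * s)\<bar> \<le> D * (C * (decay2 k * 4))"
      using D by (rule mult_left_mono)
    then show ?thesis by (simp add: norm_c_coeff D_def z_def s_def ac_simps)
  qed
  define F where "F = {k. norm2 k < real_of_int P}"
  have "F \<subseteq> {-P..P} \<times> {-P..P}"
  proof
    fix k assume "k \<in> F"
    moreover have "\<bar>real_of_int (fst k)\<bar> \<le> norm2 k" "\<bar>real_of_int (snd k)\<bar> \<le> norm2 k"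
      by (simp_all add: norm2_def real_sqrt_sum_squares_ge1 real_sqrt_sum_squares_ge2
          flip: real_sqrt_abs)
    ultimately have "\<bar>real_of_int (fst k)\<bar> < real_of_int P" "\<bar>real_of_int (snd k)\<bar> < real_of_int P"
      by (auto simp: F_def)
    then show "k \<in> {-P..P} \<times> {-P..P}" by (cases k) auto
  qed
  then have F: "finite F" by (rule finite_subset) simp
  \<comment> \<open>The sum of the nonnegative ratios dominates each of them.\<close>
  define A where "A = (\<Sum>k\<in>F. norm (c_coeff k m n) / decay2 k)"
  have A0: "A \<ge> 0" unfolding A_def by (intro sum_nonneg divide_nonneg_pos decay2_pos) simp
  have "norm (c_coeff k m n) \<le> (4 * D * C + A + 1) * decay2 k" for k
  proof (cases "k \<in> F")
    case True
    have "norm (c_coeff k m n) / decay2 k \<le> A"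
      unfolding A_def using F True
      by (intro member_le_sum) (auto intro: divide_nonneg_pos decay2_pos)
    then have "norm (c_coeff k m n) \<le> A * decay2 k"
      using decay2_pos [of k] by (simp add: pos_divide_le_eq)
    also have "\<dots> \<le> (4 * D * C + A + 1) * decay2 k"
      using C(1) D decay2_pos [of k] by (intro mult_right_mono) auto
    finally show ?thesis .
  next
    case False
    then have "norm (c_coeff k m n) \<le> (4 * D * C) * decay2 k" by (intro far) (simp add: F_def)
    also have "\<dots> \<le> (4 * D * C + A + 1) * decay2 k"
      using A0 decay2_pos [of k] by (intro mult_right_mono) auto
    finally show ?thesis .
  qed
  moreover have "4 * D * C + A + 1 > 0" using A0 C(1) D by (simp add: add_nonneg_pos)
  ultimately show ?thesis by blast
qed

section \<open>Assembling the error bound\<close>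

lemma fourier_mode_eq_cis:
  "fourier_mode k (x, y) = cis (pi * of_int (fst k) * x) * cis (pi * of_int (snd k) * y)"
  by (simp add: fourier_mode_def cis_conv_exp exp_add [symmetric] algebra_simps)

text \<open>The exact series truncated to the box, \<open>T\<close>, is the intermediate term. Its
  tail pairs \<open>A / K\<close> with the summable Fourier coefficients; the rest pairs the
  quadrature error, at most \<open>24 * M / K\<close>, with the summable majorant
  \<open>decay2\<close>.\<close>

lemma finite_fourier_bessel_error:
  assumes cont: "continuous_on UNIV f" and supp: "supp f \<subseteq> ball 0 1"
    and lip1: "\<And>x x' y. x \<in> {-1..1} \<Longrightarrow> x' \<in> {-1..1} \<Longrightarrow> y \<in> {-1..1} \<Longrightarrow> norm (f (x, y) - f (x', y)) \<le> M * \<bar>x - x'\<bar>"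
    and lip2: "\<And>x y y'. x \<in> {-1..1} \<Longrightarrow> y \<in> {-1..1} \<Longrightarrow> y' \<in> {-1..1} \<Longrightarrow> norm (f (x, y) - f (x, y')) \<le> M * \<bar>y - y'\<bar>"
    and M: "M \<ge> 0"
    and summ: "(\<lambda>k. norm (fourier_coeff f k)) summable_on UNIV"
    and n: "n \<ge> 1" and K: "K \<ge> 1"
    and A: "A > 0" "\<And>k. norm (c_coeff k m n) \<le> A * decay2 k"
  shows "norm (fourier_bessel_coeff m n f - finite_fourier_bessel K m n f)
    \<le> A * (infsum (\<lambda>k. norm (fourier_coeff f k)) UNIV + 24 * M * infsum decay2 UNIV) / real K"
proof -
  define S W where "S = infsum (\<lambda>k. norm (fourier_coeff f k)) UNIV" and "W = infsum decay2 UNIV"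
  define Q where "Q = {k :: int \<times> int. max \<bar>fst k\<bar> \<bar>snd k\<bar> \<le> int K}"
  have "Q \<subseteq> {- int K..int K} \<times> {- int K..int K}" by (auto simp: Q_def)
  then have Q: "finite Q" by (rule finite_subset) simp
  define T where "T = (\<Sum>k\<in>Q. c_coeff k m n * fourier_coeff f k)"
  have "((\<lambda>k. fourier_coeff f k * fourier_mode k p) has_sum 4 * f p) UNIV" if "p \<in> ball 0 1" for p
  proof -
    obtain x y where p: "p = (x, y)" by (cases p)
    have "\<bar>x\<bar> < 1" "\<bar>y\<bar> < 1"
      using that norm_fst_le [of x y] norm_snd_le [of y x] by (auto simp: p)
    then show ?thesis
      unfolding p fourier_mode_eq_cis
      by (intro fourier_inversion_2d [OF cont supp lip1 lip2 summ]) auto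
  qed
  then have hs: "((\<lambda>k. c_coeff k m n * fourier_coeff f k) has_sum fourier_bessel_coeff m n f) UNIV"
    by (rule has_sum_fourier_bessel_coeff [OF n cont summ])
  have 1: "norm (fourier_bessel_coeff m n f - T) \<le> A / real K * S"
  proof -
    have "norm (fourier_bessel_coeff m n f - T) \<le>
        A / real K * infsum (\<lambda>k. norm (fourier_coeff f k)) (UNIV - Q)"
    proof (rule norm_infsum_le)
      show "((\<lambda>k. c_coeff k m n * fourier_coeff f k) has_sum (fourier_bessel_coeff m n f - T)) (UNIV - Q)"
        unfolding T_def by (intro has_sum_Diff hs has_sum_finite Q) auto
      show "((\<lambda>k. A / real K * norm (fourier_coeff f k)) has_sum
          A / real K * infsum (\<lambda>k. norm (fourier_coeff f k)) (UNIV - Q)) (UNIV - Q)"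
        by (intro has_sum_cmult_right has_sum_infsum summable_on_subset [OF summ]) auto
      fix k assume "k \<in> UNIV - Q"
      then have "A * decay2 k \<le> A * (1 / real K)"
        using A(1) K by (intro mult_left_mono decay2_le_inverse) (auto simp: Q_def)
      with A(2) [of k] have "norm (c_coeff k m n) \<le> A / real K" by simp
      then show "norm (c_coeff k m n * fourier_coeff f k) \<le> A / real K * norm (fourier_coeff f k)"
        unfolding norm_mult by (rule mult_right_mono) simp
    qed
    also have "infsum (\<lambda>k. norm (fourier_coeff f k)) (UNIV - Q) \<le> S"
      unfolding S_def by (intro infsum_mono2 summ summable_on_subset [OF summ]) auto
    finally show ?thesis using A(1) by (simp add: mult_left_mono divide_right_mono)
  qed
  have "T - finite_fourier_bessel K m n f =
      (\<Sum>k\<in>Q. c_coeff k m n * (fourier_coeff f k - finite_fourier (2 * K + 1) f k))"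
    by (simp add: T_def finite_fourier_bessel_def Q_def right_diff_distrib sum_subtractf)
  also have "norm \<dots> \<le> (\<Sum>k\<in>Q. A * decay2 k * (24 * M / real K))"
  proof (intro order_trans [OF norm_sum] sum_mono)
    fix k assume k: "k \<in> Q"
    have "norm (fourier_coeff f k - finite_fourier (2 * K + 1) f k) \<le> 48 * M / real (2 * K + 1)"
      using finite_fourier_error [OF cont supp lip1 lip2, of "fst k" K "snd k"] k by (simp add: Q_def)
    also have "\<dots> \<le> 48 * M / real (2 * K)" using M K by (intro divide_left_mono) auto
    finally have "norm (fourier_coeff f k - finite_fourier (2 * K + 1) f k) \<le> 24 * M / real K" by simp
    then show "norm (c_coeff k m n * (fourier_coeff f k - finite_fourier (2 * K + 1) f k))
        \<le> A * decay2 k * (24 * M / real K)"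
      unfolding norm_mult using A(1) decay2_pos [of k] by (intro mult_mono A(2)) auto
  qed
  also have "\<dots> = A * (24 * M / real K) * (\<Sum>k\<in>Q. decay2 k)"
    unfolding sum_distrib_left by (intro sum.cong) (simp_all add: ac_simps)
  also have "\<dots> \<le> A * (24 * M / real K) * W"
    unfolding W_def using A(1) M
    by (intro mult_left_mono finite_sum_le_infsum decay2_summable Q) (auto simp: decay2_pos less_imp_le)
  finally have 2: "norm (T - finite_fourier_bessel K m n f) \<le> A * (24 * M / real K) * W" .
  have "norm (fourier_bessel_coeff m n f - finite_fourier_bessel K m n f)
      \<le> A / real K * S + A * (24 * M / real K) * W"
    using norm_diff_triangle_le [OF 1 2] .
  also have "\<dots> = A * (S + 24 * M * W) / real K"
    using K by (simp add: field_simps)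
  finally show ?thesis by (simp only: S_def W_def)
qed

theorem theorem3p5:
  shows "\<exists>(\<gamma> :: int \<Rightarrow> nat \<Rightarrow> real) (c :: (real \<times> real \<Rightarrow> complex) \<Rightarrow> real).
    (\<forall>m n. n \<ge> 1 \<longrightarrow> \<gamma> m n > 0) \<and>
    (\<forall>f \<in> Cdiff 1 \<inter> abs_conv_fourier. supp f \<subseteq> ball 0 1 \<longrightarrow>
       c f > 0 \<and>
       (\<forall>(m::int) (n::nat). n \<ge> 1 \<longrightarrow>
          (\<forall>K::nat. K \<ge> 1 \<longrightarrow> int K \<ge> K_min m n \<longrightarrow>
             norm (fourier_bessel_coeff m n f - finite_fourier_bessel K m n f)
               \<le> 2 * \<gamma> m n * c f / real K)))"
proof -
  \<comment> \<open>\<open>\<gamma>\<close> is the decay constant of the coefficients, chosen before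
    any \<open>f\<close> is considered.\<close>
  obtain \<gamma> where \<gamma>: "\<And>m n. \<gamma> m n > 0" "\<And>k m n. norm (c_coeff k m n) \<le> \<gamma> m n * decay2 k"
    using c_coeff_bound by metis
  have "\<exists>c>0. \<forall>m n K. n \<ge> 1 \<longrightarrow> K \<ge> 1 \<longrightarrow>
      norm (fourier_bessel_coeff m n f - finite_fourier_bessel K m n f) \<le> 2 * \<gamma> m n * c / real K"
    if f: "f \<in> Cdiff 1" "f \<in> abs_conv_fourier" "supp f \<subseteq> ball 0 1" for f
  proof -
    have cont: "continuous_on UNIV f" using f(1) by auto
    have summ: "(\<lambda>k. norm (fourier_coeff f k)) summable_on UNIV"
      using f(2) by (simp add: abs_conv_fourier_def)
    obtain M where M: "M \<ge> 0"
      "\<And>x x' y. x \<in> {-1..1} \<Longrightarrow> x' \<in> {-1..1} \<Longrightarrow> y \<in> {-1..1} \<Longrightarrow> norm (f (x, y) - f (x', y)) \<le> M * \<bar>x - x'\<bar>"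
      "\<And>x y y'. x \<in> {-1..1} \<Longrightarrow> y \<in> {-1..1} \<Longrightarrow> y' \<in> {-1..1} \<Longrightarrow> norm (f (x, y) - f (x, y')) \<le> M * \<bar>y - y'\<bar>"
      using Cdiff_Suc_0_lipschitz [OF f(1)] by blast
    define b where "b = infsum (\<lambda>k. norm (fourier_coeff f k)) UNIV + 24 * M * infsum decay2 UNIV"
    have b: "b \<ge> 0"
      unfolding b_def using M(1)
      by (intro add_nonneg_nonneg mult_nonneg_nonneg infsum_nonneg) (auto simp: decay2_pos less_imp_le)
    show ?thesis
    \<comment> \<open>\<open>b\<close> depends on \<open>f\<close> alone but is 0 for
      \<open>f = 0\<close>; \<open>b + 1\<close> is always positive.\<close>
    proof (intro exI [of _ "b + 1"] conjI allI impI)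
      fix m :: int and n K :: nat assume n: "n \<ge> 1" and K: "K \<ge> 1"
      have "norm (fourier_bessel_coeff m n f - finite_fourier_bessel K m n f) \<le> \<gamma> m n * b / real K"
        unfolding b_def
        by (rule finite_fourier_bessel_error [OF cont f(3) M(2,3,1) summ n K \<gamma>])
      also have "\<gamma> m n * b / real K \<le> \<gamma> m n * (2 * (b + 1)) / real K"
        using b \<gamma>(1) [of m n] by (intro divide_right_mono mult_left_mono) auto
      also have "\<gamma> m n * (2 * (b + 1)) = 2 * \<gamma> m n * (b + 1)" by simp
      finally show "norm (fourier_bessel_coeff m n f - finite_fourier_bessel K m n f)
          \<le> 2 * \<gamma> m n * (b + 1) / real K" .
    qed (use b in simp)
  qed
  then have "\<exists>c. \<forall>f \<in> Cdiff 1 \<inter> abs_conv_fourier. supp f \<subseteq> ball 0 1 \<longrightarrow>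
      c f > 0 \<and> (\<forall>m n K. n \<ge> 1 \<longrightarrow> K \<ge> 1 \<longrightarrow>
      norm (fourier_bessel_coeff m n f - finite_fourier_bessel K m n f) \<le> 2 * \<gamma> m n * c f / real K)"
    by (intro bchoice) blast
  then show ?thesis using \<gamma>(1) by (intro exI [of _ \<gamma>]) blast
qed

end
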